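(* Consider the adaptive linear model $y_t=\boldsymbol{x}_t^\top\boldsymbol{\theta}^*+\epsilon_t$ described in the context, with noise satisfying, for some $\delta>0$, $$\mathbb{E}[\epsilon_t\mid\mathcal{F}_{t-1}]=0,\qquad \mathbb{E}[\epsilon_t^2\mid\mathcal{F}_{t-1}]=\sigma^2,\qquad \sup_{t\ge 1}\mathbb{E}[|\epsilon_t/\sigma|^{2+\delta}\mid\mathcal{F}_{t-1}]<\infty .$$ Suppose the weights $\boldsymbol{w}_t\in\mathbb{R}^d$, $1\le t\le n$, are predictable (each $\boldsymbol{w}_t$ is $\mathcal{F}_{t-1}$-measurable; the weights may depend on $n$) and that, as $n\to\infty$, $$\max_{1\le t\le n}\|\boldsymbol{w}_t\|_2=o_p(1)\qquad\text{and}\qquad \big\|\mathbf{I}_d-\mathbf{W}_n^\top\mathbf{W}_n\big\|_{\mathrm{op}}=o_p(1),$$ where $\mathbf{W}_n=(\boldsymbol{w}_1,\ldots,\boldsymbol{w}_n)^\top\in\mathbb{R}^{n\times d}$. Let $\mathbf{W}_n=\mathbf{U}_w\mathbf{\Lambda}_w\mathbf{V}_w^\top$ be the singular value decomposition of $\mathbf{W}_n$, let $\mathbf{X}_n=(\boldsymbol{x}_1,\ldots,\boldsymbol{x}_n)^\top\in\mathbb{R}^{n\times d}$, and let $\mathbf{A}_w=\mathbf{V}_w\mathbf{U}_w^\top\mathbf{X}_n$. Let $\widehat{\boldsymbol{\theta}}_{\mathrm{ALEE}}$ be a solution of $$\sum_{t=1}^n\boldsymbol{w}_t\,(y_t-\boldsymbol{x}_t^\top\widehat{\boldsymbol{\theta}}_{\mathrm{ALEE}})=\mathbf{0},$$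 and let $\widehat\sigma$ be any consistent estimator of $\sigma$. Then, as $n\to\infty$, $$\mathbf{A}_w(\widehat{\boldsymbol{\theta}}_{\mathrm{ALEE}}-\boldsymbol{\theta}^* )/\widehat\sigma\ \overset{d}{\longrightarrow}\ \mathcal{N}(\mathbf{0},\mathbf{I}_d).$$
   Context: Adaptive linear model: the dimension $d$ is fixed, $\boldsymbol{\theta}^*\in\mathbb{R}^d$ is an unknown deterministic parameter, $\sigma>0$, and $y_t=\boldsymbol{x}_t^\top\boldsymbol{\theta}^*+\epsilon_t$ is a scalar response for $t\in[n]$, with covariate $\boldsymbol{x}_t\in\mathbb{R}^d$. There is an increasing sequence of $\sigma$-fields $\{\mathcal{F}_t\}_{t\ge 0}$ such that $\sigma(\boldsymbol{x}_1,y_1,\ldots,\boldsymbol{x}_{t-1},y_{t-1},\boldsymbol{x}_t)\subseteq\mathcal{F}_{t-1}$ for each $t$ (so $\boldsymbol{x}_t$ is $\mathcal{F}_{t-1}$-measurable and $y_t,\epsilon_t$ are $\mathcal{F}_t$-measurable). All asymptotics are as $n\to\infty$; $o_p(1)$ denotes convergence to zero in probability; $\|\cdot\|_{\mathrm{op}}$ is the operator norm. The singular value decomposition is the thin one: $\mathbf{U}_w\in\mathbb{R}^{n\times d}$ with orthonormal columns, $\mathbf{\Lambda}_w$ a $d\times d$ nonnegative diagonal matrix, $\mathbf{V}_w\in\mathbb{R}^{d\times d}$ orthogonal. A consistent estimator of $\sigma$ is a sequence of random variables $\widehat\sigma=\widehat\sigma_n$ converging to $\sigma$ in probability. *)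

theory Defs
  imports "HOL-Probability.Probability"
begin

text \<open>
  Since \<open>n\<close> varies, a real matrix with \<open>n\<close> rows and columns indexed by a finite type \<open>'d\<close> is
  represented by its rows \<open>P 1, \<dots>, P n\<close> for a function \<open>P :: nat \<Rightarrow> real^'d\<close>; values of \<open>P\<close>
  outside \<open>{1..n}\<close> are irrelevant.
\<close>

text \<open>\<open>transpose_mult n P Q\<close> is \<open>P\<^sup>T Q\<close>.\<close>

definition transpose_mult :: "nat \<Rightarrow> (nat \<Rightarrow> real^'d) \<Rightarrow> (nat \<Rightarrow> real^'e) \<Rightarrow> real^'e^'d"
  where "transpose_mult n P Q = (\<chi> i j. \<Sum>t=1..n. P t $ i * Q t $ j)"

text \<open>
  \<open>W = U \<Lambda> V\<^sup>T\<close>, compared row by row: row \<open>t\<close> of \<open>U B\<close> is \<open>U t v* B\<close>.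
  Orthonormality of the columns of \<open>U\<close> forces \<open>CARD('d) \<le> n\<close>.
\<close>

definition is_thin_svd ::
  "nat \<Rightarrow> (nat \<Rightarrow> real^'d) \<Rightarrow> (nat \<Rightarrow> real^'d) \<Rightarrow> real^'d^'d \<Rightarrow> real^'d^'d \<Rightarrow> bool"
  where "is_thin_svd n W U \<Lambda> V \<longleftrightarrow>
    transpose_mult n U U = mat 1 \<and>
    (\<forall>i j. i \<noteq> j \<longrightarrow> \<Lambda> $ i $ j = 0) \<and> (\<forall>i. 0 \<le> \<Lambda> $ i $ i) \<and>
    orthogonal_matrix V \<and>
    (\<forall>t\<in>{1..n}. W t = U t v* (\<Lambda> ** transpose V))"

definition tendsto_in_prob ::
  "'a measure \<Rightarrow> (nat \<Rightarrow> 'a \<Rightarrow> 'b::metric_space) \<Rightarrow> 'b \<Rightarrow> bool"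
  where "tendsto_in_prob M X c \<longleftrightarrow>
    (\<forall>n. X n \<in> borel_measurable M) \<and>
    (\<forall>e>0. (\<lambda>n. measure M {\<omega> \<in> space M. dist (X n \<omega>) c > e}) \<longlonglongrightarrow> 0)"

definition tendsto_in_distribution ::
  "'a measure \<Rightarrow> (nat \<Rightarrow> 'a \<Rightarrow> 'b::topological_space) \<Rightarrow> 'b measure \<Rightarrow> bool"
  where "tendsto_in_distribution M X \<mu> \<longleftrightarrow>
    (\<forall>n. X n \<in> borel_measurable M) \<and>
    (\<forall>f::'b \<Rightarrow> real. continuous_on UNIV f \<longrightarrow> bounded (range f) \<longrightarrow>
      (\<lambda>n. \<integral>\<omega>. f (X n \<omega>) \<partial>M) \<longlonglongrightarrow> (\<integral>z. f z \<partial>\<mu>))"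

definition std_gaussian :: "'b::euclidean_space measure"
  where "std_gaussian = density lborel
    (\<lambda>z. ennreal ((2 * pi) powr (- real DIM('b) / 2) * exp (- (norm z)\<^sup>2 / 2)))"

end

theory Submission
  imports Defs
begin

text \<open>
  Write \<open>S\<close> for the score \<open>W\<^sup>T \<epsilon>\<close> and \<open>Z = A\<^sub>w (\<theta>\<^sub>A\<^sub>L\<^sub>E\<^sub>E - \<theta>)\<close>. The estimating equation reads
  \<open>V \<Lambda> V\<^sup>T Z = S\<close>, and \<open>|1 - \<lambda>| \<le> |1 - \<lambda>\<^sup>2|\<close> for \<open>\<lambda> \<ge> 0\<close> gives \<open>|Z - S| \<le> r |Z|\<close>, where \<open>r\<close> is the
  operator norm of \<open>I - W\<^sup>T W\<close>. So \<open>Z / \<sigma>_hat\<close> differs from \<open>S / \<sigma>\<close> by a relative error that vanishes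
  in probability, and it suffices that \<open>S / \<sigma>\<close> is asymptotically standard Gaussian.

  The characteristic function of \<open>S / \<sigma>\<close> at \<open>u\<close> is that of a scalar martingale with increments
  \<open>a\<^sub>t e\<^sub>t\<close>, where \<open>a\<^sub>t = u \<bullet> w\<^sub>t\<close> is predictable and \<open>e\<^sub>t = \<epsilon>\<^sub>t / \<sigma>\<close>. After a predictable truncation of
  the \<open>a\<^sub>t\<close>, the expectation of \<open>exp (i \<Sum>\<^sub>t a\<^sub>t e\<^sub>t + \<Sum>\<^sub>t a\<^sub>t\<^sup>2 / 2)\<close> telescopes and is close to 1, while
  \<open>\<Sum>\<^sub>t a\<^sub>t\<^sup>2\<close> is close to \<open>|u|\<^sup>2\<close>. Convergence of characteristic functions implies convergence
  in distribution: a continuous compactly supported function is uniformly close to its Gaussian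
  smoothing, whose expectation is an integral of the characteristic function by Fubini.
\<close>

section \<open>The standard Gaussian measure\<close>

lemma norm_power2_eq_sum_Basis: "(norm z)\<^sup>2 = (\<Sum>b\<in>Basis. (z \<bullet> b)\<^sup>2)" for z :: "'b::euclidean_space"
  unfolding power2_norm_eq_inner by (subst euclidean_inner) (simp add: power2_eq_square)

text \<open>The squared norm is the sum of the squared coordinates, so the density factorises. In
  this form total mass and characteristic function reduce to one-dimensional facts.\<close>

lemma std_gaussian_eq_prod:
  "std_gaussian = density lborel (\<lambda>z::'b::euclidean_space. ennreal (\<Prod>b\<in>Basis. std_normal_density (z \<bullet> b)))"
proof -
  have *: "(2 * pi) powr (- real DIM('b) / 2) * exp (- (norm z)\<^sup>2 / 2) =
      (\<Prod>b\<in>Basis. std_normal_density (z \<bullet> b))" for z :: 'b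
  proof -
    have "(\<Prod>b\<in>Basis. std_normal_density (z \<bullet> b)) =
      (1 / sqrt (2 * pi)) ^ DIM('b) * exp (\<Sum>b\<in>Basis. - (z \<bullet> b)\<^sup>2 / 2)"
      by (simp add: std_normal_density_def exp_sum power_divide prod_dividef)
    also have "(1 / sqrt (2 * pi)) ^ DIM('b) = (2 * pi) powr (- real DIM('b) / 2)"
      by (simp add: powr_half_sqrt [symmetric] powr_realpow [symmetric] powr_powr
          powr_minus field_simps powr_divide)
    also have "(\<Sum>b\<in>Basis. - (z \<bullet> b)\<^sup>2 / 2) = - (norm z)\<^sup>2 / 2"
      by (simp add: norm_power2_eq_sum_Basis sum_negf sum_divide_distrib)
    finally show ?thesis by simp
  qed
  show ?thesis unfolding std_gaussian_def * ..
qed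

lemma sets_std_gaussian [measurable_cong, simp]: "sets std_gaussian = sets borel"
  by (simp add: std_gaussian_def)

lemma space_std_gaussian [simp]: "space std_gaussian = UNIV"
  by (simp add: std_gaussian_def)

lemma prob_space_std_gaussian: "prob_space (std_gaussian :: 'b::euclidean_space measure)"
proof
  have one: "(\<integral>\<^sup>+x. ennreal (std_normal_density x) \<partial>lborel) = 1"
    using prob_space.emeasure_space_1[OF prob_space_normal_density[of 1 0]]
    by (simp add: emeasure_density)
  have "emeasure (std_gaussian :: 'b measure) UNIV =
      (\<integral>\<^sup>+(z::'b). (\<Prod>b\<in>Basis. ennreal (std_normal_density (z \<bullet> b))) \<partial>lborel)"
    by (simp add: std_gaussian_eq_prod emeasure_density prod_ennreal)
  also have "\<dots> = (\<Prod>b\<in>(Basis::'b set). 1)"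
    by (subst nn_integral_lborel_prod) (simp_all add: one)
  finally show "emeasure (std_gaussian :: 'b measure) (space std_gaussian) = 1" by simp
qed

text \<open>Both the density and \<open>iexp (u \<bullet> z)\<close> are products over the
  coordinates, and \<open>lborel\<close> is the image of a product measure, so Fubini leaves a
  product of one-dimensional normal characteristic functions.\<close>

lemma char_std_gaussian:
  "(CLINT z|std_gaussian. iexp (u \<bullet> z)) = complex_of_real (exp (- (norm (u::'b::euclidean_space))\<^sup>2 / 2))"
proof -
  interpret product_sigma_finite "\<lambda>_::'b. lborel :: real measure" by standard
  have int: "integrable lborel (\<lambda>x. std_normal_density x *\<^sub>R iexp (c * x))" for c
    using integrable_density[of "\<lambda>x. iexp (c * x)" lborel std_normal_density]
      prob_space.integrable_iexp[OF prob_space_normal_density[of 1 0], of "\<lambda>x. complex_of_real (c * x)"]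
    by (simp add: measurable_lborel1)
  have "(CLINT z|std_gaussian. iexp (u \<bullet> z)) =
      (CLINT z|lborel. (\<Prod>b\<in>Basis. std_normal_density (z \<bullet> b)) *\<^sub>R iexp (u \<bullet> z))"
    by (simp add: std_gaussian_eq_prod integral_density prod_nonneg)
  also have "\<dots> = (CLINT z|lborel. (\<Prod>b\<in>Basis. std_normal_density (z \<bullet> b) *\<^sub>R iexp ((u \<bullet> b) * (z \<bullet> b))))"
  proof (intro Bochner_Integration.integral_cong refl)
    fix z :: 'b
    have "iexp (u \<bullet> z) = (\<Prod>b\<in>Basis. iexp ((u \<bullet> b) * (z \<bullet> b)))"
      by (subst euclidean_inner) (simp add: exp_sum [symmetric] sum_distrib_left)
    then show "(\<Prod>b\<in>Basis. std_normal_density (z \<bullet> b)) *\<^sub>R iexp (u \<bullet> z) =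
      (\<Prod>b\<in>Basis. std_normal_density (z \<bullet> b) *\<^sub>R iexp ((u \<bullet> b) * (z \<bullet> b)))"
      by (simp add: scaleR_conv_of_real prod.distrib)
  qed
  also have "\<dots> = (CLINT f|(\<Pi>\<^sub>M b\<in>Basis. lborel).
      (\<Prod>b\<in>Basis. std_normal_density (f b) *\<^sub>R iexp ((u \<bullet> b) * f b)))"
    by (subst lborel_eq, subst integral_distr) (auto intro!: Bochner_Integration.integral_cong prod.cong)
  also have "\<dots> = (\<Prod>b\<in>Basis. CLINT x|lborel. std_normal_density x *\<^sub>R iexp ((u \<bullet> b) * x))"
    using int by (intro product_integral_prod) auto
  also have "\<dots> = (\<Prod>b\<in>Basis. complex_of_real (exp (- (u \<bullet> b)\<^sup>2 / 2)))"
  proof (intro prod.cong refl)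
    fix b :: 'b
    have "(CLINT x|lborel. std_normal_density x *\<^sub>R iexp ((u \<bullet> b) * x)) = char std_normal_distribution (u \<bullet> b)"
      by (simp add: char_def integral_density)
    then show "(CLINT x|lborel. std_normal_density x *\<^sub>R iexp ((u \<bullet> b) * x)) = complex_of_real (exp (- (u \<bullet> b)\<^sup>2 / 2))"
      by (simp add: char_std_normal_distribution)
  qed
  also have "\<dots> = complex_of_real (exp (\<Sum>b\<in>Basis. - (u \<bullet> b)\<^sup>2 / 2))"
    by (subst exp_sum) (simp_all only: of_real_prod finite_Basis)
  also have "(\<Sum>b\<in>Basis. - (u \<bullet> b)\<^sup>2 / 2) = - (norm u)\<^sup>2 / 2"
    by (simp add: norm_power2_eq_sum_Basis sum_negf sum_divide_distrib)
  finally show ?thesis .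
qed

section \<open>Levy's continuity theorem in Euclidean space\<close>

text \<open>Norms are finite, so the tail events decrease to the empty set and continuity from above
  applies.\<close>

lemma (in prob_space) ex_norm_tail_less:
  fixes X :: "'a \<Rightarrow> 'b::{real_normed_vector, second_countable_topology}"
  assumes [measurable]: "X \<in> borel_measurable M" and "0 < e"
  shows "\<exists>K>0. measure M {\<omega> \<in> space M. norm (X \<omega>) > K} < e"
proof -
  define A where "A n = {\<omega> \<in> space M. norm (X \<omega>) > real n}" for n
  have [measurable]: "A n \<in> sets M" for n
    unfolding A_def by measurable
  have "decseq A"
    unfolding A_def decseq_def by (auto intro: le_less_trans[rotated])
  then have "(\<lambda>n. measure M (A n)) \<longlonglongrightarrow> measure M (\<Inter>n. A n)"
    by (intro finite_Lim_measure_decseq) auto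
  also have "(\<Inter>n. A n) = {}"
    unfolding A_def using reals_Archimedean2 by (auto dest: less_asym)
  finally have "\<forall>\<^sub>F n in sequentially. measure M (A n) < e"
    using \<open>0 < e\<close> by (intro order_tendstoD) auto
  \<comment> \<open>The index \<open>Suc n\<close> makes the threshold strictly positive.\<close>
  then obtain n where "measure M (A (Suc n)) < e"
    unfolding eventually_sequentially by (meson le_SucI order_refl)
  then show ?thesis
    unfolding A_def by (intro exI[of _ "real (Suc n)"]) auto
qed

section \<open>Gaussian smoothing and its Fourier representation\<close>

definition gauss_smooth :: "real \<Rightarrow> ('b::euclidean_space \<Rightarrow> real) \<Rightarrow> 'b \<Rightarrow> real"
  where "gauss_smooth \<tau> f z = (\<integral>v. f (z + \<tau> *\<^sub>R v) \<partial>std_gaussian)"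

text \<open>Smoothing averages \<open>f\<close> over a random displacement \<open>\<tau> v\<close>.
  Displacements with \<open>norm v > K\<close> are rare and cost at most \<open>2 * B\<close>; all
  others are shorter than the modulus of uniform continuity.\<close>

lemma gauss_smooth_approx:
  fixes f :: "'b::euclidean_space \<Rightarrow> real"
  assumes uc: "uniformly_continuous_on UNIV f" and B: "\<And>z. \<bar>f z\<bar> \<le> B" and "0 < e"
  shows "\<exists>\<tau>>0. \<forall>z. \<bar>gauss_smooth \<tau> f z - f z\<bar> \<le> e"
proof -
  interpret G: prob_space "std_gaussian :: 'b measure" by (rule prob_space_std_gaussian)
  have f_meas [measurable]: "f \<in> borel_measurable borel"
    using uc by (intro borel_measurable_continuous_onI uniformly_continuous_imp_continuous)
  have B0: "0 \<le> B" using B[of 0] by linarith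
  obtain d where d: "d > 0" "\<And>z z'. dist z' z < d \<Longrightarrow> dist (f z') (f z) < e / 2"
    using uc \<open>0 < e\<close> unfolding uniformly_continuous_on_def by (metis UNIV_I half_gt_zero)
  \<comment> \<open>With this tail bound the rare displacements contribute at most
    \<open>e / 2\<close>; \<open>B + 1\<close> keeps the denominator positive when
    \<open>B = 0\<close>.\<close>
  obtain K where K: "K > 0" "measure std_gaussian {v \<in> space std_gaussian. norm (v::'b) > K} < e / (4 * (B + 1))"
    using G.ex_norm_tail_less[of "\<lambda>v. v" "e / (4 * (B + 1))"] \<open>0 < e\<close> B0 by auto
  define p where "p = measure std_gaussian {v::'b. norm v > K}"
  have p: "2 * B * p \<le> e / 2"
  proof -
    have "2 * B * p \<le> 2 * (B + 1) * p" by (intro mult_right_mono) (auto simp: p_def)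
    also have "\<dots> \<le> 2 * (B + 1) * (e / (4 * (B + 1)))"
      using K B0 by (intro mult_left_mono) (auto simp: p_def)
    also have "\<dots> = e / 2" using B0 by (simp add: field_simps)
    finally show ?thesis .
  qed
  \<comment> \<open>For \<open>norm v \<le> K\<close> the displacement is then at most
    \<open>d / 2\<close>.\<close>
  define \<tau> where "\<tau> = d / (2 * K)"
  have "\<tau> > 0" using d K by (simp add: \<tau>_def)
  moreover have "\<bar>gauss_smooth \<tau> f z - f z\<bar> \<le> e" for z
  proof -
    have int: "integrable std_gaussian (\<lambda>v. f (z + \<tau> *\<^sub>R v))"
      by (rule G.integrable_const_bound[of _ B]) (use B in auto)
    have pw: "\<bar>f (z + \<tau> *\<^sub>R v) - f z\<bar> \<le> e / 2 + 2 * B * indicator {v. norm v > K} v" for v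
    proof (cases "norm v > K")
      case True
      then show ?thesis using B[of z] B[of "z + \<tau> *\<^sub>R v"] \<open>0 < e\<close> by (simp add: abs_le_iff)
    next
      case False
      have "\<tau> * norm v \<le> \<tau> * K" using False \<open>\<tau> > 0\<close> by (intro mult_left_mono) auto
      also have "\<dots> < d" using d K by (simp add: \<tau>_def)
      finally have "dist (z + \<tau> *\<^sub>R v) z < d" using \<open>\<tau> > 0\<close> by (simp add: dist_norm)
      from d(2)[OF this] show ?thesis using False by (simp add: dist_real_def)
    qed
    have "\<bar>gauss_smooth \<tau> f z - f z\<bar> = \<bar>\<integral>v. f (z + \<tau> *\<^sub>R v) - f z \<partial>std_gaussian\<bar>"
      using int G.prob_space by (simp add: gauss_smooth_def)
    also have "\<dots> \<le> (\<integral>v. \<bar>f (z + \<tau> *\<^sub>R v) - f z\<bar> \<partial>std_gaussian)"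
      by (rule integral_abs_bound)
    also have "\<dots> \<le> (\<integral>v. e / 2 + 2 * B * indicator {v::'b. norm v > K} v \<partial>std_gaussian)"
      using int pw by (intro integral_mono) (auto simp: G.emeasure_eq_measure)
    also have "\<dots> = e / 2 + 2 * B * p"
      using G.prob_space by (subst Bochner_Integration.integral_add) (auto simp: p_def G.emeasure_eq_measure)
    also have "\<dots> \<le> e" using p by simp
    finally show ?thesis .
  qed
  ultimately show ?thesis by blast
qed

definition gauss_const :: "'b::euclidean_space itself \<Rightarrow> real"
  where "gauss_const _ = (2 * pi) powr (- real DIM('b) / 2)"

text \<open>The substitution \<open>a = z + \<tau> v\<close> has Jacobian
  \<open>\<tau> ^ DIM('b)\<close>. It moves the dependence on \<open>z\<close> from \<open>f\<close>
  to the Gaussian kernel, which can be expanded into exponentials.\<close>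

lemma gauss_smooth_eq:
  fixes f :: "'b::euclidean_space \<Rightarrow> real"
  assumes [measurable]: "f \<in> borel_measurable borel" and "0 < \<tau>"
  shows "gauss_smooth \<tau> f z =
    gauss_const TYPE('b) / \<tau> ^ DIM('b) * (\<integral>a. f a * exp (- (norm ((a - z) /\<^sub>R \<tau>))\<^sup>2 / 2) \<partial>lborel)"
proof -
  let ?h = "\<lambda>a. f a * exp (- (norm ((a - z) /\<^sub>R \<tau>))\<^sup>2 / 2)"
  have [simp]: "inverse \<tau> * (\<tau> * r) = r" for r using \<open>0 < \<tau>\<close> by simp
  have "(\<integral>a. ?h a \<partial>lborel) = \<tau> ^ DIM('b) * (\<integral>v. f (z + \<tau> *\<^sub>R v) * exp (- (norm v)\<^sup>2 / 2) \<partial>lborel)"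
    using \<open>0 < \<tau>\<close>
    by (subst lborel_affine[of \<tau> z], simp, subst integral_density)
       (simp_all add: integral_distr)
  moreover have "gauss_smooth \<tau> f z = gauss_const TYPE('b) * (\<integral>v. f (z + \<tau> *\<^sub>R v) * exp (- (norm v)\<^sup>2 / 2) \<partial>lborel)"
    unfolding gauss_smooth_def std_gaussian_def
    by (subst integral_density) (simp_all add: gauss_const_def ac_simps flip: integral_mult_right_zero)
  ultimately show ?thesis using \<open>0 < \<tau>\<close> by simp
qed

text \<open>The Gaussian kernel is itself the characteristic function of a Gaussian. Inserting that
  integral and applying Fubini twice leaves \<open>N\<close> only through its characteristic
  function, averaged over Gaussian frequencies rescaled by \<open>\<tau>\<close>.\<close>

lemma integral_gauss_smooth_fourier:
  fixes f :: "'b::euclidean_space \<Rightarrow> real"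
  assumes f: "integrable lborel f" and "0 < \<tau>" and "prob_space N" and [measurable_cong, simp]: "sets N = sets borel"
  shows "complex_of_real (\<integral>z. gauss_smooth \<tau> f z \<partial>N) =
    complex_of_real (gauss_const TYPE('b) / \<tau> ^ DIM('b)) *
    (CLINT v|std_gaussian. (CLINT a|lborel. f a * iexp (v \<bullet> (a /\<^sub>R \<tau>))) * (CLINT z|N. iexp ((- v /\<^sub>R \<tau>) \<bullet> z)))"
proof -
  interpret N: prob_space N by fact
  interpret G: prob_space "std_gaussian :: 'b measure" by (rule prob_space_std_gaussian)
  interpret LG: pair_sigma_finite "lborel :: 'b measure" "std_gaussian :: 'b measure" ..
  interpret NG: pair_sigma_finite N "std_gaussian :: 'b measure" ..
  interpret NGp: pair_prob_space N "std_gaussian :: 'b measure" ..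
  have [measurable]: "f \<in> borel_measurable borel" using f by simp
  define C where "C = gauss_const TYPE('b) / \<tau> ^ DIM('b)"
  define F where "F v = (CLINT a|lborel. f a * iexp (v \<bullet> (a /\<^sub>R \<tau>)))" for v
  have F_meas [measurable]: "F \<in> borel_measurable borel"
    unfolding F_def by measurable
  have F_bound: "cmod (F v) \<le> (\<integral>a. \<bar>f a\<bar> \<partial>lborel)" for v
    unfolding F_def using integral_norm_bound[of lborel "\<lambda>a. f a * iexp (v \<bullet> (a /\<^sub>R \<tau>))"]
    by (simp add: norm_mult)
  have point: "complex_of_real (gauss_smooth \<tau> f z) =
      complex_of_real C * (CLINT v|std_gaussian. F v * iexp ((- v /\<^sub>R \<tau>) \<bullet> z))" for z
  proof -
    have "complex_of_real (\<integral>a. f a * exp (- (norm ((a - z) /\<^sub>R \<tau>))\<^sup>2 / 2) \<partial>lborel) =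
        (CLINT a|lborel. f a * complex_of_real (exp (- (norm ((a - z) /\<^sub>R \<tau>))\<^sup>2 / 2)))"
      by (subst integral_complex_of_real[symmetric]) simp
    \<comment> \<open>\<open>char_std_gaussian\<close> is read from right to left, at the point
      \<open>(a - z) /\<^sub>R \<tau>\<close>.\<close>
    also have "\<dots> = (CLINT a|lborel. f a * (CLINT v|std_gaussian. iexp (((a - z) /\<^sub>R \<tau>) \<bullet> v)))"
      by (simp only: char_std_gaussian)
    also have "\<dots> = (CLINT a|lborel. (CLINT v|std_gaussian. f a * iexp (((a - z) /\<^sub>R \<tau>) \<bullet> v)))"
      by simp
    also have "\<dots> = (CLINT v|std_gaussian. (CLINT a|lborel. f a * iexp (((a - z) /\<^sub>R \<tau>) \<bullet> v)))"
    proof (rule LG.Fubini_integral[symmetric])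
      have "integrable (lborel \<Otimes>\<^sub>M std_gaussian) (\<lambda>(a, v::'b). f a)"
        using f by (intro LG.Fubini_integrable) (auto simp: G.prob_space)
      then show "integrable (lborel \<Otimes>\<^sub>M std_gaussian) (\<lambda>(a, v). f a * iexp (((a - z) /\<^sub>R \<tau>) \<bullet> v))"
        by (rule Bochner_Integration.integrable_bound) (auto simp: norm_mult split_beta')
    qed
    also have "\<dots> = (CLINT v|std_gaussian. F v * iexp ((- v /\<^sub>R \<tau>) \<bullet> z))"
    proof (intro Bochner_Integration.integral_cong refl)
      fix v :: 'b
      have "iexp (((a - z) /\<^sub>R \<tau>) \<bullet> v) = iexp (v \<bullet> (a /\<^sub>R \<tau>)) * iexp ((- v /\<^sub>R \<tau>) \<bullet> z)" for a
        by (simp add: exp_add [symmetric] inner_diff_left inner_commute algebra_simps divide_simps)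
      then have "(CLINT a|lborel. f a * iexp (((a - z) /\<^sub>R \<tau>) \<bullet> v)) =
          (CLINT a|lborel. (f a * iexp (v \<bullet> (a /\<^sub>R \<tau>))) * iexp ((- v /\<^sub>R \<tau>) \<bullet> z))"
        by (simp only: mult.assoc)
      also have "\<dots> = F v * iexp ((- v /\<^sub>R \<tau>) \<bullet> z)"
        unfolding F_def by (rule integral_mult_left_zero)
      finally show "(CLINT a|lborel. f a * iexp (((a - z) /\<^sub>R \<tau>) \<bullet> v)) = F v * iexp ((- v /\<^sub>R \<tau>) \<bullet> z)" .
    qed
    finally have *: "complex_of_real (\<integral>a. f a * exp (- (norm ((a - z) /\<^sub>R \<tau>))\<^sup>2 / 2) \<partial>lborel) = \<dots>" .
    show ?thesis
      by (subst gauss_smooth_eq) (simp_all only: of_real_mult C_def * \<open>0 < \<tau>\<close> \<open>f \<in> borel_measurable borel\<close>)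
  qed
  have "complex_of_real (\<integral>z. gauss_smooth \<tau> f z \<partial>N) = (CLINT z|N. complex_of_real (gauss_smooth \<tau> f z))"
    by (rule integral_complex_of_real[symmetric])
  also have "\<dots> = complex_of_real C * (CLINT z|N. (CLINT v|std_gaussian. F v * iexp ((- v /\<^sub>R \<tau>) \<bullet> z)))"
    unfolding point by simp
  \<comment> \<open>The second exchange takes place on a product of probability measures with an
    integrand bounded by the L1 norm of \<open>f\<close>.\<close>
  also have "(CLINT z|N. (CLINT v|std_gaussian. F v * iexp ((- v /\<^sub>R \<tau>) \<bullet> z))) =
      (CLINT v|std_gaussian. (CLINT z|N. F v * iexp ((- v /\<^sub>R \<tau>) \<bullet> z)))"
    by (rule NG.Fubini_integral[symmetric], rule NGp.integrable_const_bound[of _ "\<integral>a. \<bar>f a\<bar> \<partial>lborel"])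
       (use F_bound in \<open>auto simp: norm_mult split_beta'\<close>)
  finally show ?thesis unfolding C_def F_def by simp
qed

text \<open>Integrals of the smoothed function converge, being Gaussian averages of characteristic
  functions that converge pointwise and are dominated. Smoothing changes each integral by at most
  \<open>e / 4\<close>, uniformly over all probability measures, so the limit can be transferred
  back to \<open>f\<close>.\<close>

lemma levy_continuity_compact_support:
  fixes f :: "'b::euclidean_space \<Rightarrow> real"
  assumes N: "\<And>n. prob_space (N n)" and N_sets: "\<And>n. sets (N n) = sets borel"
    and \<mu>: "prob_space \<mu>" and \<mu>_sets: "sets \<mu> = sets borel"
    and char: "\<And>u. (\<lambda>n. CLINT z|N n. iexp (u \<bullet> z)) \<longlonglongrightarrow> (CLINT z|\<mu>. iexp (u \<bullet> z))"
    and cont: "continuous_on UNIV f" and supp: "\<And>z. norm z > R \<Longrightarrow> f z = 0"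
  shows "(\<lambda>n. \<integral>z. f z \<partial>N n) \<longlonglongrightarrow> (\<integral>z. f z \<partial>\<mu>)"
proof -
  interpret G: prob_space "std_gaussian :: 'b measure" by (rule prob_space_std_gaussian)
  have f_meas [measurable]: "f \<in> borel_measurable borel"
    using cont by (rule borel_measurable_continuous_onI)
  have "bounded (f ` cball 0 R)"
    by (intro compact_imp_bounded compact_continuous_image continuous_on_subset[OF cont]) auto
  then obtain B where "B > 0" and B': "\<And>z. norm z \<le> R \<Longrightarrow> \<bar>f z\<bar> \<le> B"
    unfolding bounded_pos by (auto simp: mem_cball_0)
  then have B: "\<bar>f z\<bar> \<le> B" for z
    using supp[of z] by (cases "norm z \<le> R") auto
  \<comment> \<open>Two points at distance below 1 either both lie in the ball of radius
    \<open>R + 1\<close>, where Heine-Cantor applies, or both lie outside the ball of radius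
    \<open>R\<close>, where \<open>f\<close> vanishes.\<close>
  have uc: "uniformly_continuous_on UNIV f"
    unfolding uniformly_continuous_on_def
  proof (intro allI impI)
    fix e :: real assume "0 < e"
    have "uniformly_continuous_on (cball 0 (R + 1)) f"
      by (intro compact_uniformly_continuous continuous_on_subset[OF cont]) auto
    then obtain d where d: "d > 0" "\<And>z z'. norm z \<le> R + 1 \<Longrightarrow> norm z' \<le> R + 1 \<Longrightarrow> dist z' z < d \<Longrightarrow> dist (f z') (f z) < e"
      using \<open>0 < e\<close> unfolding uniformly_continuous_on_def by (metis mem_cball_0)
    have "dist (f z') (f z) < e" if "dist z' z < min d 1" for z z'
    proof (cases "norm z \<le> R + 1 \<and> norm z' \<le> R + 1")
      case True then show ?thesis using d that by auto
    next
      case False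
      have "\<bar>norm z' - norm z\<bar> < 1"
        using that norm_triangle_ineq3[of z' z] by (simp add: dist_norm)
      then have "norm z > R" "norm z' > R" using False by linarith+
      then show ?thesis using supp \<open>0 < e\<close> by simp
    qed
    then show "\<exists>d>0. \<forall>z\<in>UNIV. \<forall>z'\<in>UNIV. dist z' z < d \<longrightarrow> dist (f z') (f z) < e"
      using d(1) by (intro exI[of _ "min d 1"]) auto
  qed
  have int: "integrable lborel f"
  proof -
    have "integrable lborel (\<lambda>z. indicator (cball 0 R) z *\<^sub>R f z)"
      by (intro borel_integrable_compact continuous_on_subset[OF cont]) auto
    also have "(\<lambda>z. indicator (cball 0 R) z *\<^sub>R f z) = f"
      using supp by (auto simp: fun_eq_iff indicator_def not_le)
    finally show ?thesis .
  qed
  have smooth: "(\<lambda>n. \<integral>z. gauss_smooth \<tau> f z \<partial>N n) \<longlonglongrightarrow> (\<integral>z. gauss_smooth \<tau> f z \<partial>\<mu>)" if "\<tau> > 0" for \<tau>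
  proof -
    let ?F = "\<lambda>v::'b. CLINT a|lborel. f a * iexp (v \<bullet> (a /\<^sub>R \<tau>))"
    have F_bound: "cmod (?F v) \<le> (\<integral>a. \<bar>f a\<bar> \<partial>lborel)" for v
      using integral_norm_bound[of lborel "\<lambda>a. f a * iexp (v \<bullet> (a /\<^sub>R \<tau>))"]
      by (simp add: norm_mult)
    have char_le: "cmod (CLINT z|N n. iexp (u \<bullet> z)) \<le> 1" for n u
    proof -
      interpret prob_space "N n" by (rule N)
      show ?thesis using integral_norm_bound[of "N n" "\<lambda>z. iexp (u \<bullet> z)"] by (simp add: prob_space)
    qed
    have meas: "(\<lambda>u. CLINT z|P. iexp (u \<bullet> z)) \<in> borel_measurable borel"
      if "prob_space P" and [measurable_cong]: "sets P = sets (borel :: 'b measure)" for P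
    proof -
      interpret prob_space P by fact
      show ?thesis by measurable
    qed
    have "(\<lambda>n. CLINT v|std_gaussian. ?F v * (CLINT z|N n. iexp ((- v /\<^sub>R \<tau>) \<bullet> z))) \<longlonglongrightarrow>
        (CLINT v|std_gaussian. ?F v * (CLINT z|\<mu>. iexp ((- v /\<^sub>R \<tau>) \<bullet> z)))"
    \<comment> \<open>Characteristic functions have modulus at most 1, so the L1 norm of
      \<open>f\<close> is a constant dominating function, integrable under the Gaussian law.\<close>
    proof (rule integral_dominated_convergence[where w="\<lambda>_. \<integral>a. \<bar>f a\<bar> \<partial>lborel"])
      show "AE v in std_gaussian. cmod (?F v * (CLINT z|N n. iexp ((- v /\<^sub>R \<tau>) \<bullet> z))) \<le> (\<integral>a. \<bar>f a\<bar> \<partial>lborel)" for n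
      proof (rule AE_I2)
        fix v :: 'b
        have "cmod (?F v * (CLINT z|N n. iexp ((- v /\<^sub>R \<tau>) \<bullet> z))) \<le> (\<integral>a. \<bar>f a\<bar> \<partial>lborel) * 1"
          unfolding norm_mult by (intro mult_mono F_bound char_le) auto
        then show "cmod (?F v * (CLINT z|N n. iexp ((- v /\<^sub>R \<tau>) \<bullet> z))) \<le> (\<integral>a. \<bar>f a\<bar> \<partial>lborel)" by simp
      qed
      show "AE v in std_gaussian. (\<lambda>n. ?F v * (CLINT z|N n. iexp ((- v /\<^sub>R \<tau>) \<bullet> z))) \<longlonglongrightarrow>
        ?F v * (CLINT z|\<mu>. iexp ((- v /\<^sub>R \<tau>) \<bullet> z))"
        by (intro AE_I2 tendsto_intros char)
      show "integrable std_gaussian (\<lambda>v::'b. \<integral>a. \<bar>f a\<bar> \<partial>lborel)" by simp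
      show "(\<lambda>v. ?F v * (CLINT z|\<mu>. iexp ((- v /\<^sub>R \<tau>) \<bullet> z))) \<in> borel_measurable std_gaussian"
        using measurable_compose[OF _ meas[OF \<mu> \<mu>_sets], of "\<lambda>v. - v /\<^sub>R \<tau>" std_gaussian]
        by (intro borel_measurable_times) (simp_all, measurable)
      show "(\<lambda>v. ?F v * (CLINT z|N n. iexp ((- v /\<^sub>R \<tau>) \<bullet> z))) \<in> borel_measurable std_gaussian" for n
        using measurable_compose[OF _ meas[OF N N_sets], of "\<lambda>v. - v /\<^sub>R \<tau>" std_gaussian n]
        by (intro borel_measurable_times) (simp_all, measurable)
    qed
    from tendsto_mult_left[OF this, of "complex_of_real (gauss_const TYPE('b) / \<tau> ^ DIM('b))"]
    have "(\<lambda>n. complex_of_real (\<integral>z. gauss_smooth \<tau> f z \<partial>N n)) \<longlonglongrightarrow> complex_of_real (\<integral>z. gauss_smooth \<tau> f z \<partial>\<mu>)"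
      by (simp only: integral_gauss_smooth_fourier[OF int that N N_sets]
          integral_gauss_smooth_fourier[OF int that \<mu> \<mu>_sets])
    then show ?thesis by (simp only: tendsto_of_real_iff)
  qed
  show ?thesis
  proof (rule LIMSEQ_I)
    fix e :: real assume "0 < e"
    obtain \<tau> where \<tau>: "\<tau> > 0" "\<And>z. \<bar>gauss_smooth \<tau> f z - f z\<bar> \<le> e / 4"
      using gauss_smooth_approx[OF uc B, of "e / 4"] \<open>0 < e\<close> by auto
    have close: "\<bar>(\<integral>z. gauss_smooth \<tau> f z \<partial>P) - (\<integral>z. f z \<partial>P)\<bar> \<le> e / 4"
      if "prob_space P" and [measurable_cong]: "sets P = sets (borel :: 'b measure)" for P
    proof -
      interpret prob_space P by fact
      have 1: "integrable P f"
        by (rule integrable_const_bound[of _ B]) (use B in auto)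
      have 2: "integrable P (\<lambda>z. gauss_smooth \<tau> f z - f z)"
        unfolding gauss_smooth_def
        by (rule integrable_const_bound[of _ "e / 4"]) (use \<tau>(2) in \<open>auto simp: gauss_smooth_def\<close>)
      have "(\<integral>z. gauss_smooth \<tau> f z \<partial>P) - (\<integral>z. f z \<partial>P) = (\<integral>z. gauss_smooth \<tau> f z - f z \<partial>P)"
        using Bochner_Integration.integral_add[OF 1 2] by simp
      also have "\<bar>\<dots>\<bar> \<le> (\<integral>z. e / 4 \<partial>P)"
        by (rule order_trans[OF integral_abs_bound], rule integral_mono) (use 2 \<tau>(2) in auto)
      finally show ?thesis by (simp add: prob_space)
    qed
    obtain n0 where n0: "\<And>n. n \<ge> n0 \<Longrightarrow> \<bar>(\<integral>z. gauss_smooth \<tau> f z \<partial>N n) - (\<integral>z. gauss_smooth \<tau> f z \<partial>\<mu>)\<bar> < e / 4"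
      using LIMSEQ_D[OF smooth[OF \<tau>(1)], of "e / 4"] \<open>0 < e\<close> by auto
    have "norm ((\<integral>z. f z \<partial>N n) - (\<integral>z. f z \<partial>\<mu>)) < e" if "n \<ge> n0" for n
      using close[OF N N_sets, of n] close[OF \<mu> \<mu>_sets] n0[OF that] by (simp add: abs_if split: if_splits)
    then show "\<exists>n0. \<forall>n\<ge>n0. norm ((\<integral>z. f z \<partial>N n) - (\<integral>z. f z \<partial>\<mu>)) < e" by blast
  qed
qed

text \<open>A continuous cutoff \<open>h\<close> reduces the claim to compact support. No mass can
  escape to infinity under \<open>N n\<close>: the compactly supported case applied to
  \<open>h\<close> itself shows that the integral of \<open>h\<close> stays close to its value under
  \<open>\<mu>\<close>, which is nearly 1.\<close>

theorem levy_continuity_euclidean: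
  fixes f :: "'b::euclidean_space \<Rightarrow> real"
  assumes N: "\<And>n. prob_space (N n)" and N_sets: "\<And>n. sets (N n) = sets borel"
    and \<mu>: "prob_space \<mu>" and \<mu>_sets: "sets \<mu> = sets borel"
    and char: "\<And>u. (\<lambda>n. CLINT z|N n. iexp (u \<bullet> z)) \<longlonglongrightarrow> (CLINT z|\<mu>. iexp (u \<bullet> z))"
    and cont: "continuous_on UNIV f" and bdd: "bounded (range f)"
  shows "(\<lambda>n. \<integral>z. f z \<partial>N n) \<longlonglongrightarrow> (\<integral>z. f z \<partial>\<mu>)"
proof (rule LIMSEQ_I)
  fix e :: real assume "0 < e"
  interpret \<mu>: prob_space \<mu> by fact
  obtain B where "B > 0" and B: "\<And>z. \<bar>f z\<bar> \<le> B"
    using bdd unfolding bounded_pos by auto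
  have f_meas [measurable]: "f \<in> borel_measurable borel"
    using cont by (rule borel_measurable_continuous_onI)
  \<comment> \<open>Removing the cutoff costs at most \<open>B * p\<close> under
    \<open>\<mu>\<close> and \<open>2 * B * p\<close> under \<open>N n\<close>, together
    \<open>3 * e / 8\<close>; the remaining \<open>e / 2\<close> covers the truncated
    integrals.\<close>
  define p where "p = e / (8 * B)"
  have "p > 0" using \<open>0 < e\<close> \<open>B > 0\<close> by (simp add: p_def)
  note [measurable_cong] = \<mu>_sets
  obtain K where K: "measure \<mu> {z \<in> space \<mu>. norm z > K} < p"
    using \<mu>.ex_norm_tail_less[of "\<lambda>z. z" p] \<open>p > 0\<close> by auto
  \<comment> \<open>The cutoff is 1 on the ball of radius \<open>K\<close> and 0 outside radius
    \<open>K + 1\<close>, so \<open>1 - h\<close> lies below the indicator of the tail that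
    \<open>K\<close> controls.\<close>
  define h :: "'b \<Rightarrow> real" where "h z = max 0 (min 1 (K + 1 - norm z))" for z
  have h_cont: "continuous_on UNIV h"
    unfolding h_def by (intro continuous_intros)
  have [measurable]: "h \<in> borel_measurable borel"
    using h_cont by (rule borel_measurable_continuous_onI)
  have h01: "0 \<le> h z" "h z \<le> 1" for z by (auto simp: h_def)
  have h_supp: "h z = 0" if "norm z > K + 1" for z using that by (simp add: h_def)
  have lim_h: "(\<lambda>n. \<integral>z. h z \<partial>N n) \<longlonglongrightarrow> (\<integral>z. h z \<partial>\<mu>)"
    by (rule levy_continuity_compact_support[OF N N_sets \<mu> \<mu>_sets char h_cont h_supp])
  have lim_fh: "(\<lambda>n. \<integral>z. f z * h z \<partial>N n) \<longlonglongrightarrow> (\<integral>z. f z * h z \<partial>\<mu>)"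
    by (rule levy_continuity_compact_support[OF N N_sets \<mu> \<mu>_sets char, where R="K + 1"])
       (use cont h_cont h_supp in \<open>auto intro!: continuous_intros\<close>)
  have tail: "\<bar>(\<integral>z. f z \<partial>P) - (\<integral>z. f z * h z \<partial>P)\<bar> \<le> B * (1 - (\<integral>z. h z \<partial>P))" and int_h: "integrable P h"
    if "prob_space P" and [measurable_cong]: "sets P = sets (borel :: 'b measure)" for P
  proof -
    interpret prob_space P by fact
    have "\<bar>f z * h z\<bar> \<le> B" for z
      using mult_mono[OF B h01(2) _ h01(1), of z z] \<open>B > 0\<close> h01[of z] by (simp add: abs_mult)
    then have 1: "integrable P f" "integrable P h" "integrable P (\<lambda>z. f z * h z)"
      using B h01 by (auto intro!: integrable_const_bound[of _ B] integrable_const_bound[of h 1])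
    have "(\<integral>z. f z \<partial>P) - (\<integral>z. f z * h z \<partial>P) = (\<integral>z. f z - f z * h z \<partial>P)"
      using 1 by simp
    also have "\<bar>\<dots>\<bar> \<le> (\<integral>z. B * (1 - h z) \<partial>P)"
    proof (rule order_trans[OF integral_abs_bound], rule integral_mono)
      fix z
      have "f z - f z * h z = f z * (1 - h z)" by (simp add: algebra_simps)
      then show "\<bar>f z - f z * h z\<bar> \<le> B * (1 - h z)"
        using B[of z] h01[of z] by (simp add: abs_mult mult_right_mono)
    qed (use 1 in auto)
    finally show "\<bar>(\<integral>z. f z \<partial>P) - (\<integral>z. f z * h z \<partial>P)\<bar> \<le> B * (1 - (\<integral>z. h z \<partial>P))"
      using 1 by (simp add: prob_space)
    show "integrable P h" by fact
  qed
  have h\<mu>: "1 - (\<integral>z. h z \<partial>\<mu>) < p"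
  proof -
    have "1 - (\<integral>z. h z \<partial>\<mu>) = (\<integral>z. 1 - h z \<partial>\<mu>)"
      using int_h[OF \<mu> \<mu>_sets] by (simp add: \<mu>.prob_space)
    also have "\<dots> \<le> (\<integral>z. indicator {z \<in> space \<mu>. norm z > K} z \<partial>\<mu>)"
    proof (rule integral_mono)
      show "1 - h z \<le> indicator {z \<in> space \<mu>. norm z > K} z" if "z \<in> space \<mu>" for z
        using that by (auto simp: h_def indicator_def)
    qed (use int_h[OF \<mu> \<mu>_sets] in \<open>auto simp: \<mu>.emeasure_eq_measure\<close>)
    finally show ?thesis using K by simp
  qed
  obtain n1 where n1: "\<And>n. n \<ge> n1 \<Longrightarrow> \<bar>(\<integral>z. h z \<partial>N n) - (\<integral>z. h z \<partial>\<mu>)\<bar> < p"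
    using LIMSEQ_D[OF lim_h, of p] \<open>p > 0\<close> by auto
  obtain n2 where n2: "\<And>n. n \<ge> n2 \<Longrightarrow> \<bar>(\<integral>z. f z * h z \<partial>N n) - (\<integral>z. f z * h z \<partial>\<mu>)\<bar> < e / 2"
    using LIMSEQ_D[OF lim_fh, of "e / 2"] \<open>0 < e\<close> by auto
  have "norm ((\<integral>z. f z \<partial>N n) - (\<integral>z. f z \<partial>\<mu>)) < e" if n: "n \<ge> max n1 n2" for n
  proof -
    have "B * (1 - (\<integral>z. h z \<partial>\<mu>)) \<le> B * p"
      using h\<mu> \<open>B > 0\<close> by (intro mult_left_mono) auto
    moreover have "B * (1 - (\<integral>z. h z \<partial>N n)) \<le> B * (2 * p)"
    proof (intro mult_left_mono)
      show "1 - (\<integral>z. h z \<partial>N n) \<le> 2 * p" using n1[of n] n h\<mu> by auto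
    qed (use \<open>B > 0\<close> in auto)
    moreover have "B * p = e / 8" using \<open>B > 0\<close> by (simp add: p_def)
    moreover have "\<bar>(\<integral>z. f z * h z \<partial>N n) - (\<integral>z. f z * h z \<partial>\<mu>)\<bar> < e / 2" using n2[of n] n by simp
    ultimately show ?thesis
      using tail[OF N N_sets, of n] tail[OF \<mu> \<mu>_sets] \<open>0 < e\<close> by (simp only: real_norm_def abs_le_iff abs_less_iff) linarith
  qed
  then show "\<exists>n0. \<forall>n\<ge>n0. norm ((\<integral>z. f z \<partial>N n) - (\<integral>z. f z \<partial>\<mu>)) < e" by blast
qed

section \<open>Convergence in distribution, tightness and relative perturbations\<close>

lemma cmod_iexp_diff_le: "cmod (iexp a - iexp b) \<le> \<bar>a - b\<bar>"
proof -
  have "iexp a - iexp b = iexp b * (iexp (a - b) - 1)"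
    by (simp add: algebra_simps exp_diff)
  then have "cmod (iexp a - iexp b) = cmod (iexp (a - b) - 1)"
    by (simp add: norm_mult)
  also have "\<dots> \<le> \<bar>a - b\<bar>" using iexp_approx1[of "a - b" 0] by simp
  finally show ?thesis .
qed

lemma cmod_iexp_diff_le_2: "cmod (iexp a - iexp b) \<le> 2"
  using norm_triangle_ineq4[of "iexp a" "iexp b"] by simp

lemma (in prob_space) tendsto_in_distribution_charI:
  fixes X :: "nat \<Rightarrow> 'a \<Rightarrow> 'b::euclidean_space"
  assumes [measurable]: "\<And>n. X n \<in> borel_measurable M"
    and "prob_space \<mu>" "sets \<mu> = sets borel"
    and char: "\<And>u. (\<lambda>n. CLINT \<omega>|M. iexp (u \<bullet> X n \<omega>)) \<longlonglongrightarrow> (CLINT z|\<mu>. iexp (u \<bullet> z))"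
  shows "tendsto_in_distribution M X \<mu>"
  unfolding tendsto_in_distribution_def
proof (intro conjI allI impI)
  fix f :: "'b \<Rightarrow> real" assume f: "continuous_on UNIV f" "bounded (range f)"
  have [measurable]: "f \<in> borel_measurable borel"
    using f(1) by (rule borel_measurable_continuous_onI)
  have "(\<lambda>n. \<integral>z. f z \<partial>distr M borel (X n)) \<longlonglongrightarrow> (\<integral>z. f z \<partial>\<mu>)"
    using char by (intro levy_continuity_euclidean prob_space_distr assms f) (simp_all add: integral_distr)
  then show "(\<lambda>n. \<integral>\<omega>. f (X n \<omega>) \<partial>M) \<longlonglongrightarrow> (\<integral>z. f z \<partial>\<mu>)"
    by (simp add: integral_distr)
qed fact

text \<open>A tail indicator is not continuous, so the test function \<open>g\<close> is squeezed
  between the indicators of \<open>norm z > K + 1\<close> and \<open>norm z > K\<close>. The bound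
  under \<open>\<mu>\<close> thus carries over at the price of enlarging the radius by 1.\<close>

lemma (in prob_space) tendsto_in_distribution_tight:
  fixes X :: "nat \<Rightarrow> 'a \<Rightarrow> 'b::euclidean_space"
  assumes X: "tendsto_in_distribution M X \<mu>" and "prob_space \<mu>" and [measurable_cong]: "sets \<mu> = sets borel"
    and "0 < p"
  shows "\<exists>K>0. \<forall>\<^sub>F n in sequentially. prob {\<omega> \<in> space M. norm (X n \<omega>) > K} < p"
proof -
  interpret \<mu>: prob_space \<mu> by fact
  have [measurable]: "X n \<in> borel_measurable M" for n
    using X by (simp add: tendsto_in_distribution_def)
  obtain K where K: "K > 0" "measure \<mu> {z \<in> space \<mu>. norm z > K} < p"
    using \<mu>.ex_norm_tail_less[of "\<lambda>z. z" p] \<open>p > 0\<close> by auto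
  define g :: "'b \<Rightarrow> real" where "g z = max 0 (min 1 (norm z - K))" for z
  have g01: "0 \<le> g z" "g z \<le> 1" for z by (auto simp: g_def)
  have g_cont: "continuous_on UNIV g" unfolding g_def by (intro continuous_intros)
  have [measurable]: "g \<in> borel_measurable borel" using g_cont by (rule borel_measurable_continuous_onI)
  have "bounded (range g)" unfolding bounded_iff using g01 by (auto intro!: exI[of _ 1])
  with g_cont X have lim: "(\<lambda>n. \<integral>\<omega>. g (X n \<omega>) \<partial>M) \<longlonglongrightarrow> (\<integral>z. g z \<partial>\<mu>)"
    by (simp add: tendsto_in_distribution_def)
  have "(\<integral>z. g z \<partial>\<mu>) \<le> (\<integral>z. indicator {z \<in> space \<mu>. norm z > K} z \<partial>\<mu>)"
  proof (rule integral_mono)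
    show "g z \<le> indicator {z \<in> space \<mu>. norm z > K} z" if "z \<in> space \<mu>" for z
      using that by (auto simp: g_def indicator_def)
    show "integrable \<mu> g" by (rule \<mu>.integrable_const_bound[of _ 1]) (use g01 in auto)
  qed (auto simp: \<mu>.emeasure_eq_measure)
  also have "\<dots> < p" using K by simp
  finally have ev: "\<forall>\<^sub>F n in sequentially. (\<integral>\<omega>. g (X n \<omega>) \<partial>M) < p"
    using lim by (rule order_tendstoD(2)[rotated])
  have "prob {\<omega> \<in> space M. norm (X n \<omega>) > K + 1} \<le> (\<integral>\<omega>. g (X n \<omega>) \<partial>M)" for n
  proof -
    have "prob {\<omega> \<in> space M. norm (X n \<omega>) > K + 1} = (\<integral>\<omega>. indicator {\<omega> \<in> space M. norm (X n \<omega>) > K + 1} \<omega> \<partial>M)"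
      by simp
    also have "\<dots> \<le> (\<integral>\<omega>. g (X n \<omega>) \<partial>M)"
    proof (rule integral_mono)
      show "indicator {\<omega> \<in> space M. norm (X n \<omega>) > K + 1} \<omega> \<le> g (X n \<omega>)" for \<omega>
        by (auto simp: g_def indicator_def)
      show "integrable M (\<lambda>\<omega>. g (X n \<omega>))" by (rule integrable_const_bound[of _ 1]) (use g01 in auto)
    qed (auto simp: emeasure_eq_measure)
    finally show ?thesis .
  qed
  with ev have "\<forall>\<^sub>F n in sequentially. prob {\<omega> \<in> space M. norm (X n \<omega>) > K + 1} < p"
    by (auto elim!: eventually_mono intro: le_less_trans)
  then show ?thesis using K(1) by (intro exI[of _ "K + 1"]) auto
qed

text \<open>This is a Slutsky argument for an error measured relative to \<open>X\<close>. Tightness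
  of \<open>X\<close> makes the relative error an absolute one outside a rare event, and
  \<open>iexp\<close> is 1-Lipschitz.\<close>

lemma (in prob_space) tendsto_in_distribution_relative_perturbation:
  fixes X Y :: "nat \<Rightarrow> 'a \<Rightarrow> 'b::euclidean_space"
  assumes X_meas [measurable]: "\<And>n. X n \<in> borel_measurable M"
    and Y_meas [measurable]: "\<And>n. Y n \<in> borel_measurable M"
    and \<mu>: "prob_space \<mu>" "sets \<mu> = sets borel"
    and char: "\<And>u. (\<lambda>n. CLINT \<omega>|M. iexp (u \<bullet> X n \<omega>)) \<longlonglongrightarrow> (CLINT z|\<mu>. iexp (u \<bullet> z))"
    and close: "\<And>c. 0 < c \<Longrightarrow>
      (\<lambda>n. prob {\<omega> \<in> space M. norm (Y n \<omega> - X n \<omega>) > c * norm (X n \<omega>)}) \<longlonglongrightarrow> 0"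
  shows "tendsto_in_distribution M Y \<mu>"
proof (rule tendsto_in_distribution_charI[OF Y_meas \<mu>])
  fix u :: 'b
  have X: "tendsto_in_distribution M X \<mu>"
    by (rule tendsto_in_distribution_charI[OF X_meas \<mu> char])
  have "(\<lambda>n. (CLINT \<omega>|M. iexp (u \<bullet> Y n \<omega>)) - (CLINT \<omega>|M. iexp (u \<bullet> X n \<omega>))) \<longlonglongrightarrow> 0"
    unfolding tendsto_iff dist_norm
  proof (intro allI impI)
    fix e :: real assume "0 < e"
    obtain K where K: "K > 0" "\<forall>\<^sub>F n in sequentially. prob {\<omega> \<in> space M. norm (X n \<omega>) > K} < e / 8"
      using tendsto_in_distribution_tight[OF X \<mu>, of "e / 8"] \<open>0 < e\<close> by auto
    \<comment> \<open>Adding 1 allows division by \<open>q\<close> also when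
      \<open>u = 0\<close>.\<close>
    define q where "q = norm u + 1"
    have q: "q > 0" "norm u \<le> q" by (auto simp: q_def intro: add_nonneg_pos)
    \<comment> \<open>On the good event the exponents then differ by at most \<open>e / 4\<close>.
      Each of the two bad events costs at most twice its probability, hence less than
      \<open>e / 4\<close>.\<close>
    define c where "c = e / (4 * q * K)"
    have "c > 0" using \<open>0 < e\<close> K q by (simp add: c_def)
    have cK: "norm u * (c * K) \<le> e / 4"
    proof -
      have "norm u * (c * K) \<le> q * (c * K)" using q \<open>c > 0\<close> K by (intro mult_right_mono) auto
      also have "\<dots> = e / 4" using K q by (simp add: c_def)
      finally show ?thesis .
    qed
    define A where "A n = {\<omega> \<in> space M. norm (X n \<omega>) > K}" for n
    define B where "B n = {\<omega> \<in> space M. norm (Y n \<omega> - X n \<omega>) > c * norm (X n \<omega>)}" for n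
    have [measurable]: "A n \<in> sets M" "B n \<in> sets M" for n
      unfolding A_def B_def by measurable
    have ev: "\<forall>\<^sub>F n in sequentially. prob (B n) < e / 8"
      unfolding B_def using close[OF \<open>c > 0\<close>] \<open>0 < e\<close> by (intro order_tendstoD) auto
    from ev K(2) show "\<forall>\<^sub>F n in sequentially.
      norm ((CLINT \<omega>|M. iexp (u \<bullet> Y n \<omega>)) - (CLINT \<omega>|M. iexp (u \<bullet> X n \<omega>)) - 0) < e"
    proof eventually_elim
      case (elim n)
      have int: "integrable M (\<lambda>\<omega>. iexp (u \<bullet> Y n \<omega>))" "integrable M (\<lambda>\<omega>. iexp (u \<bullet> X n \<omega>))"
        by (auto intro!: integrable_iexp)
      have "norm ((CLINT \<omega>|M. iexp (u \<bullet> Y n \<omega>)) - (CLINT \<omega>|M. iexp (u \<bullet> X n \<omega>)) - 0) =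
          norm (CLINT \<omega>|M. iexp (u \<bullet> Y n \<omega>) - iexp (u \<bullet> X n \<omega>))"
        using int by simp
      also have "\<dots> \<le> (\<integral>\<omega>. norm (iexp (u \<bullet> Y n \<omega>) - iexp (u \<bullet> X n \<omega>)) \<partial>M)"
        by (rule integral_norm_bound)
      also have "\<dots> \<le> (\<integral>\<omega>. e / 4 + (2 * indicator (A n) \<omega> + 2 * indicator (B n) \<omega>) \<partial>M)"
      proof (rule integral_mono)
        fix \<omega> assume \<omega>: "\<omega> \<in> space M"
        show "norm (iexp (u \<bullet> Y n \<omega>) - iexp (u \<bullet> X n \<omega>)) \<le> e / 4 + (2 * indicator (A n) \<omega> + 2 * indicator (B n) \<omega>)"
        proof (cases "\<omega> \<in> A n \<or> \<omega> \<in> B n")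
          case True
          then have "2 \<le> 2 * indicator (A n) \<omega> + 2 * (indicator (B n) \<omega> :: real)" by (auto simp: indicator_def)
          then show ?thesis using cmod_iexp_diff_le_2[of "u \<bullet> Y n \<omega>" "u \<bullet> X n \<omega>"] \<open>0 < e\<close> by linarith
        next
          case False
          then have 1: "norm (X n \<omega>) \<le> K" "norm (Y n \<omega> - X n \<omega>) \<le> c * norm (X n \<omega>)"
            using \<omega> by (auto simp: A_def B_def)
          have "\<bar>u \<bullet> Y n \<omega> - u \<bullet> X n \<omega>\<bar> \<le> norm u * norm (Y n \<omega> - X n \<omega>)"
            by (metis inner_diff_right Cauchy_Schwarz_ineq2)
          also have "\<dots> \<le> norm u * (c * K)"
            by (rule mult_left_mono[OF order_trans[OF 1(2)]]) (use 1 \<open>c > 0\<close> in auto)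
          also have "\<dots> \<le> e / 4" by (rule cK)
          finally show ?thesis
            using cmod_iexp_diff_le[of "u \<bullet> Y n \<omega>" "u \<bullet> X n \<omega>"] False by simp
        qed
      qed (use int in \<open>auto simp: emeasure_eq_measure\<close>)
      also have "\<dots> = e / 4 + (2 * prob (A n) + 2 * prob (B n))"
        by (simp add: emeasure_eq_measure prob_space)
      also have "\<dots> < e" using elim \<open>0 < e\<close> by (simp add: A_def)
      finally show ?case .
    qed
  qed
  from tendsto_add[OF this char[of u]]
  show "(\<lambda>n. CLINT \<omega>|M. iexp (u \<bullet> Y n \<omega>)) \<longlonglongrightarrow> (CLINT z|\<mu>. iexp (u \<bullet> z))" by simp
qed

section \<open>A martingale central limit theorem\<close>

lemma integrable_bounded_mult:
  fixes D :: "'a \<Rightarrow> 'c::{real_normed_algebra, second_countable_topology, banach}"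
  assumes [measurable]: "D \<in> borel_measurable M" and "\<And>\<omega>. \<omega> \<in> space M \<Longrightarrow> norm (D \<omega>) \<le> C"
    and "integrable M g"
  shows "integrable M (\<lambda>\<omega>. D \<omega> * g \<omega>)"
proof (rule Bochner_Integration.integrable_bound[of _ "\<lambda>\<omega>. C * norm (g \<omega>)"])
  show "AE \<omega> in M. norm (D \<omega> * g \<omega>) \<le> norm (C * norm (g \<omega>))"
  proof (rule AE_I2)
    fix \<omega> assume "\<omega> \<in> space M"
    then have "norm (D \<omega>) * norm (g \<omega>) \<le> C * norm (g \<omega>)" using assms(2) by (intro mult_right_mono) auto
    then show "norm (D \<omega> * g \<omega>) \<le> norm (C * norm (g \<omega>))"
      using norm_mult_ineq[of "D \<omega>" "g \<omega>"] by (simp add: abs_le_iff)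
  qed
qed (use assms in auto)

text \<open>This is the noise divided by \<open>\<sigma>\<close>, so that its conditional variance
  is 1. Index 0 carries no noise; \<open>F (t - 1)\<close> is the information available before
  \<open>e t\<close>.\<close>

locale unit_noise = prob_space M for M :: "'a measure" +
  fixes F :: "nat \<Rightarrow> 'a measure" and e :: "nat \<Rightarrow> 'a \<Rightarrow> real" and \<delta> :: real
  assumes subalg: "\<And>t. subalgebra M (F t)"
    and F_mono: "\<And>s t. s \<le> t \<Longrightarrow> sets (F s) \<subseteq> sets (F t)"
    and adapted: "\<And>t. 1 \<le> t \<Longrightarrow> e t \<in> borel_measurable (F t)"
    and \<delta>_pos: "0 < \<delta>"
    and integrable_e: "\<And>t. 1 \<le> t \<Longrightarrow> integrable M (e t)"
    and integrable_e2: "\<And>t. 1 \<le> t \<Longrightarrow> integrable M (\<lambda>\<omega>. (e t \<omega>)\<^sup>2)"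
    and cond_mean: "\<And>t. 1 \<le> t \<Longrightarrow> AE \<omega> in M. real_cond_exp M (F (t - 1)) (e t) \<omega> = 0"
    and cond_var: "\<And>t. 1 \<le> t \<Longrightarrow> AE \<omega> in M. real_cond_exp M (F (t - 1)) (\<lambda>\<omega>. (e t \<omega>)\<^sup>2) \<omega> = 1"
begin

text \<open>The value lies in \<open>ennreal\<close>, so that it makes sense before the moment of
  order \<open>2 + \<delta>\<close> is known to be integrable.\<close>

definition cond_moment :: "nat \<Rightarrow> 'a \<Rightarrow> ennreal"
  where "cond_moment t = nn_cond_exp M (F (t - 1)) (\<lambda>\<omega>. ennreal (\<bar>e t \<omega>\<bar> powr (2 + \<delta>)))"

lemma measurable_F_mono: "s \<le> t \<Longrightarrow> f \<in> measurable (F s) N \<Longrightarrow> f \<in> measurable (F t) N"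
  using F_mono[of s t] subalg by (intro measurable_from_subalg[of "F t" "F s"]) (auto simp: subalgebra_def)

lemma measurable_F_M: "f \<in> measurable (F t) N \<Longrightarrow> f \<in> measurable M N"
  by (rule measurable_from_subalg[OF subalg])

lemma sigma_finite_F: "sigma_finite_subalgebra M (F t)"
proof -
  interpret finite_measure_subalgebra M "F t" by unfold_locales (rule subalg)
  show ?thesis by (rule sigma_finite_subalgebra_axioms)
qed

lemma e_meas [measurable]: "1 \<le> t \<Longrightarrow> e t \<in> borel_measurable M"
  using integrable_e by auto

text \<open>A factor measurable with respect to \<open>F t\<close> can be pulled out of the
  conditional expectation. Conditional expectation is taken of real functions, so the real and
  imaginary parts of \<open>D\<close> are treated separately.\<close>

lemma integral_cond_exp_const:
  fixes D :: "'a \<Rightarrow> complex"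
  assumes D: "D \<in> borel_measurable (F t)" and bound: "\<And>\<omega>. \<omega> \<in> space M \<Longrightarrow> norm (D \<omega>) \<le> C"
    and g: "integrable M g" and cond: "AE \<omega> in M. real_cond_exp M (F t) g \<omega> = c"
  shows "(CLINT \<omega>|M. D \<omega> * g \<omega>) = (CLINT \<omega>|M. D \<omega>) * c"
proof -
  interpret sigma_finite_subalgebra M "F t" by (rule sigma_finite_F)
  have DM [measurable]: "D \<in> borel_measurable M" using D by (rule measurable_F_M)
  have [measurable]: "g \<in> borel_measurable M" using g by auto
  have real: "(\<integral>\<omega>. d \<omega> * g \<omega> \<partial>M) = (\<integral>\<omega>. d \<omega> \<partial>M) * c"
    if d: "d \<in> borel_measurable (F t)" "\<And>\<omega>. \<omega> \<in> space M \<Longrightarrow> \<bar>d \<omega>\<bar> \<le> C" for d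
  proof -
    have [measurable]: "d \<in> borel_measurable M" using d(1) by (rule measurable_F_M)
    have "integrable M (\<lambda>\<omega>. d \<omega> * g \<omega>)" by (rule integrable_bounded_mult[OF _ _ g]) (use d in auto)
    then have "(\<integral>\<omega>. d \<omega> * g \<omega> \<partial>M) = (\<integral>\<omega>. d \<omega> * real_cond_exp M (F t) g \<omega> \<partial>M)"
      by (subst real_cond_exp_intg(2)) (use d in auto)
    also have "\<dots> = (\<integral>\<omega>. d \<omega> * c \<partial>M)"
      using cond by (intro integral_cong_AE) auto
    finally show ?thesis by simp
  qed
  have intDg: "integrable M (\<lambda>\<omega>. D \<omega> * g \<omega>)"
    by (rule integrable_bounded_mult[OF _ bound]) (use g in auto)
  have intD: "integrable M D"
    by (rule integrable_const_bound[of _ C]) (use bound in auto)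
  have "(\<integral>\<omega>. Re (D \<omega>) * g \<omega> \<partial>M) = (\<integral>\<omega>. Re (D \<omega>) \<partial>M) * c"
    using D by (intro real order_trans[OF abs_Re_le_cmod bound]) auto
  moreover have "(\<integral>\<omega>. Im (D \<omega>) * g \<omega> \<partial>M) = (\<integral>\<omega>. Im (D \<omega>) \<partial>M) * c"
    using D by (intro real order_trans[OF abs_Im_le_cmod bound]) auto
  ultimately show ?thesis
    using integral_Re[OF intDg] integral_Im[OF intDg] integral_Re[OF intD] integral_Im[OF intD]
    by (intro complex_eqI) simp_all
qed

text \<open>Wherever the conditional moment may exceed \<open>k\<close>, the predictable factor
  \<open>D\<close> vanishes. Working with nonnegative integrals gives integrability and the bound
  from one computation.\<close>

lemma integral_cond_moment_le:
  assumes t: "1 \<le> t" and D: "D \<in> borel_measurable (F (t - 1))" and D0: "\<And>\<omega>. \<omega> \<in> space M \<Longrightarrow> 0 \<le> D \<omega>"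
    and bound: "\<And>\<omega>. \<omega> \<in> space M \<Longrightarrow> D \<omega> \<le> C"
    and k: "\<And>\<omega>. \<omega> \<in> space M \<Longrightarrow> D \<omega> \<noteq> 0 \<Longrightarrow> cond_moment t \<omega> \<le> ennreal k" and "0 \<le> k"
  shows "integrable M (\<lambda>\<omega>. D \<omega> * \<bar>e t \<omega>\<bar> powr (2 + \<delta>))"
    and "(\<integral>\<omega>. D \<omega> * \<bar>e t \<omega>\<bar> powr (2 + \<delta>) \<partial>M) \<le> k * (\<integral>\<omega>. D \<omega> \<partial>M)"
proof -
  interpret sigma_finite_subalgebra M "F (t - 1)" by (rule sigma_finite_F)
  have [measurable]: "D \<in> borel_measurable M" using D by (rule measurable_F_M)
  note [measurable] = e_meas[OF t]
  have intD: "integrable M D"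
    by (rule integrable_const_bound[of _ C]) (use D0 bound in auto)
  have "(\<integral>\<^sup>+\<omega>. ennreal (D \<omega> * \<bar>e t \<omega>\<bar> powr (2 + \<delta>)) \<partial>M) =
      (\<integral>\<^sup>+\<omega>. ennreal (D \<omega>) * ennreal (\<bar>e t \<omega>\<bar> powr (2 + \<delta>)) \<partial>M)"
    using D0 by (intro nn_integral_cong) (simp add: ennreal_mult)
  also have "\<dots> = (\<integral>\<^sup>+\<omega>. ennreal (D \<omega>) * cond_moment t \<omega> \<partial>M)"
    unfolding cond_moment_def using D by (subst nn_cond_exp_intg) auto
  also have "\<dots> \<le> (\<integral>\<^sup>+\<omega>. ennreal (k * D \<omega>) \<partial>M)"
  proof (rule nn_integral_mono)
    fix \<omega> assume \<omega>: "\<omega> \<in> space M"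
    show "ennreal (D \<omega>) * cond_moment t \<omega> \<le> ennreal (k * D \<omega>)"
    proof (cases "D \<omega> = 0")
      case False
      have "ennreal (D \<omega>) * cond_moment t \<omega> \<le> ennreal (D \<omega>) * ennreal k"
        using k[OF \<omega> False] by (intro mult_left_mono) auto
      also have "\<dots> = ennreal (k * D \<omega>)" using D0[OF \<omega>] \<open>0 \<le> k\<close> by (simp add: ennreal_mult mult.commute)
      finally show ?thesis .
    qed simp
  qed
  also have "\<dots> = ennreal (k * (\<integral>\<omega>. D \<omega> \<partial>M))"
    using intD D0 \<open>0 \<le> k\<close> by (subst nn_integral_eq_integral) auto
  finally have *: "(\<integral>\<^sup>+\<omega>. ennreal (D \<omega> * \<bar>e t \<omega>\<bar> powr (2 + \<delta>)) \<partial>M) \<le> ennreal (k * (\<integral>\<omega>. D \<omega> \<partial>M))" .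
  show int: "integrable M (\<lambda>\<omega>. D \<omega> * \<bar>e t \<omega>\<bar> powr (2 + \<delta>))"
    by (rule integrableI_nonneg) (use D0 * in \<open>auto intro: le_less_trans\<close>)
  have "ennreal (\<integral>\<omega>. D \<omega> * \<bar>e t \<omega>\<bar> powr (2 + \<delta>) \<partial>M) \<le> ennreal (k * (\<integral>\<omega>. D \<omega> \<partial>M))"
    using * by (subst nn_integral_eq_integral[OF int, symmetric]) (use D0 in auto)
  moreover have "0 \<le> k * (\<integral>\<omega>. D \<omega> \<partial>M)" using D0 \<open>0 \<le> k\<close> by (intro mult_nonneg_nonneg integral_nonneg_AE) auto
  ultimately show "(\<integral>\<omega>. D \<omega> * \<bar>e t \<omega>\<bar> powr (2 + \<delta>) \<partial>M) \<le> k * (\<integral>\<omega>. D \<omega> \<partial>M)"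
    by (simp add: ennreal_le_iff)
qed

end

section \<open>Taylor bounds for a single increment\<close>

lemma exp_minus_quadratic_bound: "0 \<le> x \<Longrightarrow> \<bar>1 - x - exp (- x)\<bar> \<le> x\<^sup>2" for x :: real
proof -
  assume x: "0 \<le> x"
  have 1: "1 - x \<le> exp (- x)" using exp_ge_add_one_self[of "- x"] by simp
  have "exp (- x) * (1 + x) \<le> exp (- x) * exp x"
    using exp_ge_add_one_self[of x] by (intro mult_left_mono) auto
  also have "\<dots> = 1" by (simp add: exp_minus)
  \<comment> \<open>The product equals \<open>1 + x ^ 3\<close>.\<close>
  also have "1 \<le> (1 - x + x\<^sup>2) * (1 + x)" using x by (simp add: algebra_simps power2_eq_square)
  finally have "exp (- x) \<le> 1 - x + x\<^sup>2" using x by simp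
  then show ?thesis using 1 by (simp add: abs_le_iff)
qed

text \<open>Cubic Taylor bound where \<open>|e| \<le> R\<close>, quadratic Taylor bound where \<open>|e| > R\<close>.\<close>

lemma iexp_remainder_bound:
  fixes b e R \<eta> \<delta> :: real
  assumes "0 < R" "0 < \<delta>" "\<bar>b\<bar> \<le> \<eta>"
  shows "cmod (iexp (b * e) - 1 - \<i> * (b * e) + (b * e)\<^sup>2 / 2) \<le>
    b\<^sup>2 * (\<eta> * R * e\<^sup>2 + R powr - \<delta> * \<bar>e\<bar> powr (2 + \<delta>))"
proof -
  define r where "r = cmod (iexp (b * e) - 1 - \<i> * (b * e) + (b * e)\<^sup>2 / 2)"
  have eq: "iexp (b * e) - (\<Sum>k\<le>2. (\<i> * (b * e))^k / fact k) = iexp (b * e) - 1 - \<i> * (b * e) + (b * e)\<^sup>2 / 2"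
    by (simp add: numeral_2_eq_2 field_simps)
  have r3: "r \<le> \<bar>b * e\<bar> ^ 3 / 6" and r2: "r \<le> (b * e)\<^sup>2"
    using iexp_approx1[of "b * e" 2] iexp_approx2[of "b * e" 2]
    unfolding r_def eq[symmetric] by (simp_all add: eval_nat_numeral)
  have \<eta>: "0 \<le> \<eta>" using assms by linarith
  show ?thesis
  proof (cases "\<bar>e\<bar> \<le> R")
    case True
    have "\<bar>b * e\<bar> ^ 3 / 6 \<le> \<bar>b * e\<bar> ^ 3" by simp
    also have "\<dots> = (b\<^sup>2 * e\<^sup>2) * (\<bar>b\<bar> * \<bar>e\<bar>)"
      using power2_abs[of "b * e"] power_Suc2[of "\<bar>b * e\<bar>" 2]
      by (simp only: Suc_eq_plus1 power_mult_distrib abs_mult) simp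
    also have "\<dots> \<le> (b\<^sup>2 * e\<^sup>2) * (\<eta> * R)"
      using True assms \<eta> by (intro mult_left_mono mult_mono) auto
    finally have "r \<le> b\<^sup>2 * (\<eta> * R * e\<^sup>2)" using r3 by (simp add: mult_ac)
    also have "\<dots> \<le> b\<^sup>2 * (\<eta> * R * e\<^sup>2 + R powr - \<delta> * \<bar>e\<bar> powr (2 + \<delta>))"
      by (intro mult_left_mono) auto
    finally show ?thesis by (simp add: r_def)
  next
    case False
    \<comment> \<open>The ratio of the two sides is a factor of at least 1 that turns the second
      moment into the moment of order \<open>2 + \<delta>\<close>, with the small coefficient
      \<open>R powr - \<delta>\<close>.\<close>
    then have "R powr \<delta> \<le> \<bar>e\<bar> powr \<delta>" using assms by (intro powr_mono2) auto
    then have "e\<^sup>2 \<le> e\<^sup>2 * (R powr - \<delta> * \<bar>e\<bar> powr \<delta>)"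
      using assms by (simp add: powr_minus divide_simps mult_left_mono)
    also have "\<dots> = R powr - \<delta> * \<bar>e\<bar> powr (2 + \<delta>)"
      using False assms by (simp add: powr_add)
    finally have "r \<le> b\<^sup>2 * (R powr - \<delta> * \<bar>e\<bar> powr (2 + \<delta>))"
      using r2 by (simp add: power_mult_distrib mult_left_mono order_trans)
    also have "\<dots> \<le> b\<^sup>2 * (\<eta> * R * e\<^sup>2 + R powr - \<delta> * \<bar>e\<bar> powr (2 + \<delta>))"
      using \<eta> assms by (intro mult_left_mono) auto
    finally show ?thesis by (simp add: r_def)
  qed
qed

section \<open>Telescoping for martingales with bounded predictable weights\<close>

context unit_noise
begin

text \<open>Expand both exponentials to second order. The linear term has conditional mean zero, and
  the quadratic terms cancel in expectation because the conditional variance is 1. What remains is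
  proportional to \<open>(b \<omega>)\<^sup>2\<close>, so that summing over time produces only the
  total variance.\<close>

lemma char_one_step_bound:
  fixes D :: "'a \<Rightarrow> complex"
  assumes t: "1 \<le> t" and D: "D \<in> borel_measurable (F (t - 1))"
    and DC: "\<And>\<omega>. \<omega> \<in> space M \<Longrightarrow> cmod (D \<omega>) \<le> C"
    and b: "b \<in> borel_measurable (F (t - 1))" and b\<eta>: "\<And>\<omega>. \<omega> \<in> space M \<Longrightarrow> \<bar>b \<omega>\<bar> \<le> \<eta>"
    and bk: "\<And>\<omega>. \<omega> \<in> space M \<Longrightarrow> b \<omega> \<noteq> 0 \<Longrightarrow> cond_moment t \<omega> \<le> ennreal k"
    and k: "0 \<le> k" and R: "0 < R"
  shows "cmod (CLINT \<omega>|M. D \<omega> * (iexp (b \<omega> * e t \<omega>) - exp (- (b \<omega>)\<^sup>2 / 2))) \<le>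
    C * (\<eta> * R + k * R powr - \<delta> + \<eta>\<^sup>2) * (\<integral>\<omega>. (b \<omega>)\<^sup>2 \<partial>M)"
proof -
  note [measurable] = e_meas[OF t] measurable_F_M[OF D] measurable_F_M[OF b]
  obtain \<omega>0 where \<omega>0: "\<omega>0 \<in> space M" using not_empty by auto
  have C: "0 \<le> C" using DC[OF \<omega>0] norm_ge_zero order_trans by blast
  have \<eta>: "0 \<le> \<eta>" using b\<eta>[OF \<omega>0] by linarith
  have b2: "(b \<omega>)\<^sup>2 \<le> \<eta>\<^sup>2" if "\<omega> \<in> space M" for \<omega>
    using power_mono[OF b\<eta>[OF that], of 2] by simp
  define Z where "Z \<omega> = D \<omega> * (iexp (b \<omega> * e t \<omega>) - exp (- (b \<omega>)\<^sup>2 / 2))" for \<omega>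
  define D1 where "D1 \<omega> = D \<omega> * (\<i> * b \<omega>)" for \<omega>
  define D2 where "D2 \<omega> = D \<omega> * ((b \<omega>)\<^sup>2 / 2)" for \<omega>
  \<comment> \<open>This subtracts the second-order expansion of \<open>Z\<close>. The terms removed
    integrate to zero in total, by \<open>z1\<close> and \<open>z2\<close>, so \<open>r\<close> and
    \<open>Z\<close> have the same integral.\<close>
  define r where "r \<omega> = Z \<omega> - D1 \<omega> * e t \<omega> - D2 \<omega> + D2 \<omega> * (e t \<omega>)\<^sup>2" for \<omega>
  have D1: "cmod (D1 \<omega>) \<le> C * \<eta>" if "\<omega> \<in> space M" for \<omega>
    unfolding D1_def norm_mult using DC[OF that] b\<eta>[OF that] C by (intro mult_mono) auto
  have D2: "cmod (D2 \<omega>) \<le> C * (\<eta>\<^sup>2 / 2)" if "\<omega> \<in> space M" for \<omega>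
    unfolding D2_def norm_mult using DC[OF that] b2[OF that] C by (intro mult_mono) (auto simp: norm_power)
  have D1_F: "D1 \<in> borel_measurable (F (t - 1))" and D2_F: "D2 \<in> borel_measurable (F (t - 1))"
    unfolding D1_def D2_def using D b by measurable
  note [measurable] = measurable_F_M[OF D1_F] measurable_F_M[OF D2_F]
  have intZ: "integrable M Z"
  proof (rule integrable_const_bound[of _ "C * 2"])
    show "AE \<omega> in M. cmod (Z \<omega>) \<le> C * 2"
    proof (rule AE_I2)
      fix \<omega> assume \<omega>: "\<omega> \<in> space M"
      have "cmod (iexp (b \<omega> * e t \<omega>) - exp (- (b \<omega>)\<^sup>2 / 2)) \<le> 1 + exp (- (b \<omega>)\<^sup>2 / 2)"
        using norm_triangle_ineq4[of "iexp (b \<omega> * e t \<omega>)" "complex_of_real (exp (- (b \<omega>)\<^sup>2 / 2))"]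
        by simp
      also have "\<dots> \<le> 2" by simp
      finally show "cmod (Z \<omega>) \<le> C * 2"
        unfolding Z_def norm_mult using DC[OF \<omega>] C by (intro mult_mono) auto
    qed
    show "Z \<in> borel_measurable M" unfolding Z_def by measurable
  qed
  have intD2: "integrable M D2"
    by (rule integrable_const_bound[of _ "C * (\<eta>\<^sup>2 / 2)"]) (use D2 in auto)
  have int1: "integrable M (\<lambda>\<omega>. D1 \<omega> * e t \<omega>)"
    by (rule integrable_bounded_mult[OF _ D1]) (use integrable_e[OF t] in auto)
  have int2: "integrable M (\<lambda>\<omega>. D2 \<omega> * (e t \<omega>)\<^sup>2)"
    by (rule integrable_bounded_mult[OF _ D2]) (use integrable_e2[OF t] in \<open>auto simp flip: of_real_power\<close>)
  have intr: "integrable M r" unfolding r_def using intZ intD2 int1 int2 by auto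
  have z1: "(CLINT \<omega>|M. D1 \<omega> * e t \<omega>) = 0"
    using integral_cond_exp_const[OF D1_F D1 integrable_e[OF t] cond_mean[OF t]] by simp
  have z2: "(CLINT \<omega>|M. D2 \<omega> * (e t \<omega>)\<^sup>2) = (CLINT \<omega>|M. D2 \<omega>)"
    using integral_cond_exp_const[OF D2_F D2 integrable_e2[OF t] cond_var[OF t]] by simp
  have eq: "(CLINT \<omega>|M. Z \<omega>) = (CLINT \<omega>|M. r \<omega>)"
    unfolding r_def using intZ intD2 int1 int2 by (simp add: z1 z2[simplified])
  have intb2: "integrable M (\<lambda>\<omega>. (b \<omega>)\<^sup>2)"
    by (rule integrable_const_bound[of _ "\<eta>\<^sup>2"]) (use b2 in auto)
  have b2_F: "(\<lambda>\<omega>. (b \<omega>)\<^sup>2) \<in> borel_measurable (F (t - 1))" using b by measurable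
  have intb2e2: "integrable M (\<lambda>\<omega>. (b \<omega>)\<^sup>2 * (e t \<omega>)\<^sup>2)"
    by (rule integrable_bounded_mult[where C="\<eta>\<^sup>2"]) (use integrable_e2[OF t] b2 in auto)
  \<comment> \<open>The factor is cast to complex numbers because
    \<open>integral_cond_exp_const\<close> is stated for complex factors.\<close>
  have "complex_of_real (\<integral>\<omega>. (b \<omega>)\<^sup>2 * (e t \<omega>)\<^sup>2 \<partial>M) = complex_of_real (\<integral>\<omega>. (b \<omega>)\<^sup>2 \<partial>M)"
    using integral_cond_exp_const[of "\<lambda>\<omega>. complex_of_real ((b \<omega>)\<^sup>2)", OF _ _ integrable_e2[OF t] cond_var[OF t], of "\<eta>\<^sup>2"] b2_F b2
    by (simp add: integral_complex_of_real flip: of_real_mult of_real_power)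
  then have var: "(\<integral>\<omega>. (b \<omega>)\<^sup>2 * (e t \<omega>)\<^sup>2 \<partial>M) = (\<integral>\<omega>. (b \<omega>)\<^sup>2 \<partial>M)"
    by (simp only: of_real_eq_iff)
  have mom: "integrable M (\<lambda>\<omega>. (b \<omega>)\<^sup>2 * \<bar>e t \<omega>\<bar> powr (2 + \<delta>))"
    "(\<integral>\<omega>. (b \<omega>)\<^sup>2 * \<bar>e t \<omega>\<bar> powr (2 + \<delta>) \<partial>M) \<le> k * (\<integral>\<omega>. (b \<omega>)\<^sup>2 \<partial>M)"
    using integral_cond_moment_le[OF t b2_F _ b2 _ k] bk by auto
  define bd where "bd \<omega> = C * (\<eta> * R * ((b \<omega>)\<^sup>2 * (e t \<omega>)\<^sup>2) +
      (R powr - \<delta> * ((b \<omega>)\<^sup>2 * \<bar>e t \<omega>\<bar> powr (2 + \<delta>)) + \<eta>\<^sup>2 * (b \<omega>)\<^sup>2))" for \<omega>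
  have rbd: "cmod (r \<omega>) \<le> bd \<omega>" if \<omega>: "\<omega> \<in> space M" for \<omega>
  proof -
    let ?r1 = "iexp (b \<omega> * e t \<omega>) - 1 - \<i> * (b \<omega> * e t \<omega>) + (b \<omega> * e t \<omega>)\<^sup>2 / 2"
    let ?r2 = "1 - (b \<omega>)\<^sup>2 / 2 - exp (- ((b \<omega>)\<^sup>2 / 2))"
    have r: "r \<omega> = D \<omega> * (?r1 + complex_of_real ?r2)"
      by (simp add: r_def Z_def D1_def D2_def algebra_simps power_mult_distrib flip: exp_of_real)
    have r1: "cmod ?r1 \<le> (b \<omega>)\<^sup>2 * (\<eta> * R * (e t \<omega>)\<^sup>2 + R powr - \<delta> * \<bar>e t \<omega>\<bar> powr (2 + \<delta>))"
      by (rule iexp_remainder_bound[OF R \<delta>_pos b\<eta>[OF \<omega>]])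
    have "\<bar>?r2\<bar> \<le> ((b \<omega>)\<^sup>2 / 2)\<^sup>2" by (rule exp_minus_quadratic_bound) simp
    also have "\<dots> = (b \<omega>)\<^sup>2 * (b \<omega>)\<^sup>2 / 4" by (simp add: power2_eq_square)
    also have "\<dots> \<le> (b \<omega>)\<^sup>2 * (b \<omega>)\<^sup>2" by simp
    also have "\<dots> \<le> \<eta>\<^sup>2 * (b \<omega>)\<^sup>2" using b2[OF \<omega>] by (intro mult_right_mono) auto
    finally have r2: "cmod (complex_of_real ?r2) \<le> \<eta>\<^sup>2 * (b \<omega>)\<^sup>2" unfolding norm_of_real .
    have "cmod (?r1 + complex_of_real ?r2) \<le> (b \<omega>)\<^sup>2 * (\<eta> * R * (e t \<omega>)\<^sup>2 + R powr - \<delta> * \<bar>e t \<omega>\<bar> powr (2 + \<delta>)) + \<eta>\<^sup>2 * (b \<omega>)\<^sup>2"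
      by (rule order_trans[OF norm_triangle_ineq add_mono[OF r1 r2]])
    also have "\<dots> = \<eta> * R * ((b \<omega>)\<^sup>2 * (e t \<omega>)\<^sup>2) +
      (R powr - \<delta> * ((b \<omega>)\<^sup>2 * \<bar>e t \<omega>\<bar> powr (2 + \<delta>)) + \<eta>\<^sup>2 * (b \<omega>)\<^sup>2)" by (simp add: algebra_simps)
    finally show ?thesis unfolding r bd_def norm_mult by (intro mult_mono DC[OF \<omega>] C) auto
  qed
  have int_bd: "integrable M bd" unfolding bd_def using intb2 intb2e2 mom(1) by auto
  have "cmod (CLINT \<omega>|M. r \<omega>) \<le> (\<integral>\<omega>. cmod (r \<omega>) \<partial>M)" by (rule integral_norm_bound)
  also have "\<dots> \<le> (\<integral>\<omega>. bd \<omega> \<partial>M)"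
    using intr int_bd rbd by (intro integral_mono) auto
  also have "\<dots> = C * (\<eta> * R * (\<integral>\<omega>. (b \<omega>)\<^sup>2 \<partial>M) +
      (R powr - \<delta> * (\<integral>\<omega>. (b \<omega>)\<^sup>2 * \<bar>e t \<omega>\<bar> powr (2 + \<delta>) \<partial>M) + \<eta>\<^sup>2 * (\<integral>\<omega>. (b \<omega>)\<^sup>2 \<partial>M)))"
    unfolding bd_def using intb2 intb2e2 mom(1) by (simp add: var)
  also have "\<dots> \<le> C * (\<eta> * R * (\<integral>\<omega>. (b \<omega>)\<^sup>2 \<partial>M) +
      (R powr - \<delta> * (k * (\<integral>\<omega>. (b \<omega>)\<^sup>2 \<partial>M)) + \<eta>\<^sup>2 * (\<integral>\<omega>. (b \<omega>)\<^sup>2 \<partial>M)))"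
    using mom(2) C \<eta> R by (intro mult_left_mono add_mono) auto
  also have "\<dots> = C * (\<eta> * R + k * R powr - \<delta> + \<eta>\<^sup>2) * (\<integral>\<omega>. (b \<omega>)\<^sup>2 \<partial>M)"
    by (simp add: algebra_simps)
  finally show ?thesis using eq by (simp add: Z_def)
qed

text \<open>The compensated exponential \<open>Y m\<close> starts at 1, and each increment is small
  by the one-step bound. The errors add up to a multiple of the expected sum of squares, which is at
  most \<open>V\<close> however large \<open>n\<close> is.\<close>

lemma char_martingale_bound:
  assumes b: "\<And>t. 1 \<le> t \<Longrightarrow> t \<le> n \<Longrightarrow> b t \<in> borel_measurable (F (t - 1))"
    and b\<eta>: "\<And>t \<omega>. 1 \<le> t \<Longrightarrow> t \<le> n \<Longrightarrow> \<omega> \<in> space M \<Longrightarrow> \<bar>b t \<omega>\<bar> \<le> \<eta>"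
    and bk: "\<And>t \<omega>. 1 \<le> t \<Longrightarrow> t \<le> n \<Longrightarrow> \<omega> \<in> space M \<Longrightarrow> b t \<omega> \<noteq> 0 \<Longrightarrow> cond_moment t \<omega> \<le> ennreal k"
    and bV: "\<And>\<omega>. \<omega> \<in> space M \<Longrightarrow> (\<Sum>t=1..n. (b t \<omega>)\<^sup>2) \<le> V"
    and k: "0 \<le> k" and R: "0 < R" and \<eta>: "0 \<le> \<eta>"
  shows "cmod ((CLINT \<omega>|M. iexp (\<Sum>t=1..n. b t \<omega> * e t \<omega>) * exp ((\<Sum>t=1..n. (b t \<omega>)\<^sup>2) / 2)) - 1) \<le>
    exp (V / 2) * (\<eta> * R + k * R powr - \<delta> + \<eta>\<^sup>2) * V"
proof -
  define c where "c = \<eta> * R + k * R powr - \<delta> + \<eta>\<^sup>2"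
  have c: "0 \<le> c" using k R \<eta> by (simp add: c_def)
  define S where "S m \<omega> = (\<Sum>t=1..m. b t \<omega> * e t \<omega>)" for m \<omega>
  define Q where "Q m \<omega> = (\<Sum>t=1..m. (b t \<omega>)\<^sup>2)" for m \<omega>
  define Y where "Y m \<omega> = iexp (S m \<omega>) * complex_of_real (exp (Q m \<omega> / 2))" for m \<omega>
  have QV: "Q m \<omega> \<le> V" if "m \<le> n" "\<omega> \<in> space M" for m \<omega>
  proof -
    have "Q m \<omega> \<le> (\<Sum>t=1..n. (b t \<omega>)\<^sup>2)" unfolding Q_def using that by (intro sum_mono2) auto
    then show ?thesis using bV[OF that(2)] by linarith
  qed
  have S_F: "S m \<in> borel_measurable (F m)" if "m \<le> n" for m
    unfolding S_def using that
    by (intro borel_measurable_sum borel_measurable_times)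
       (auto intro: measurable_F_mono[OF _ b] measurable_F_mono[OF _ adapted])
  have Q_F: "Q (Suc m) \<in> borel_measurable (F m)" if "Suc m \<le> n" for m
    unfolding Q_def using that
    by (intro borel_measurable_sum borel_measurable_power measurable_F_mono[OF _ b]) auto
  have Q_M: "Q m \<in> borel_measurable M" if "m \<le> n" for m
    unfolding Q_def using that
    by (intro borel_measurable_sum borel_measurable_power measurable_F_M[OF b]) auto
  have intY: "integrable M (Y m)" if "m \<le> n" for m
  proof (rule integrable_const_bound[of _ "exp (V / 2)"])
    show "AE \<omega> in M. cmod (Y m \<omega>) \<le> exp (V / 2)"
      unfolding Y_def norm_mult using QV[OF that] by (intro AE_I2) simp
    note [measurable] = Q_M[OF that] measurable_F_M[OF S_F[OF that]]
    show "Y m \<in> borel_measurable M" unfolding Y_def by measurable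
  qed
  have intb: "integrable M (\<lambda>\<omega>. (b t \<omega>)\<^sup>2)" if "1 \<le> t" "t \<le> n" for t
  proof (rule integrable_const_bound[of _ "\<eta>\<^sup>2"])
    show "AE \<omega> in M. norm ((b t \<omega>)\<^sup>2) \<le> \<eta>\<^sup>2"
      using power_mono[OF b\<eta>[OF that], of _ 2] by (intro AE_I2) auto
    note [measurable] = measurable_F_M[OF b[OF that]]
    show "(\<lambda>\<omega>. (b t \<omega>)\<^sup>2) \<in> borel_measurable M" by measurable
  qed
  have ind: "cmod ((CLINT \<omega>|M. Y m \<omega>) - 1) \<le> exp (V / 2) * c * (\<Sum>t=1..m. \<integral>\<omega>. (b t \<omega>)\<^sup>2 \<partial>M)"
    if "m \<le> n" for m
    using that
  proof (induction m)
    case 0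
    then show ?case by (simp add: Y_def S_def Q_def prob_space)
  next
    case (Suc m)
    \<comment> \<open>The compensator is taken at \<open>Suc m\<close>: it is still known at time
      \<open>m\<close> because the weights are predictable, and it leaves exactly the difference of
      exponentials of the one-step bound.\<close>
    define D where "D \<omega> = iexp (S m \<omega>) * complex_of_real (exp (Q (Suc m) \<omega> / 2))" for \<omega>
    have D_F: "D \<in> borel_measurable (F (Suc m - 1))"
      using S_F[of m] Q_F[of m] Suc.prems unfolding D_def by simp
    have DC: "cmod (D \<omega>) \<le> exp (V / 2)" if "\<omega> \<in> space M" for \<omega>
      unfolding D_def norm_mult using QV[OF Suc.prems that] by simp
    have diff: "Y (Suc m) \<omega> - Y m \<omega> =
        D \<omega> * (iexp (b (Suc m) \<omega> * e (Suc m) \<omega>) - exp (- (b (Suc m) \<omega>)\<^sup>2 / 2))" for \<omega>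
    proof -
      have "iexp (S (Suc m) \<omega>) = iexp (S m \<omega>) * iexp (b (Suc m) \<omega> * e (Suc m) \<omega>)"
        by (simp add: S_def exp_add algebra_simps)
      moreover have "exp (Q m \<omega> / 2) = exp (Q (Suc m) \<omega> / 2) * exp (- (b (Suc m) \<omega>)\<^sup>2 / 2)"
        by (simp add: Q_def field_simps flip: exp_add)
      then have "complex_of_real (exp (Q m \<omega> / 2)) =
          complex_of_real (exp (Q (Suc m) \<omega> / 2)) * complex_of_real (exp (- (b (Suc m) \<omega>)\<^sup>2 / 2))"
        by (simp only: of_real_mult)
      ultimately show ?thesis unfolding Y_def D_def by (simp only: algebra_simps)
    qed
    have "(CLINT \<omega>|M. Y (Suc m) \<omega>) - 1 = ((CLINT \<omega>|M. Y m \<omega>) - 1) + (CLINT \<omega>|M. Y (Suc m) \<omega> - Y m \<omega>)"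
      using intY[of m] intY[of "Suc m"] Suc.prems by simp
    also have "cmod \<dots> \<le> exp (V / 2) * c * (\<Sum>t=1..m. \<integral>\<omega>. (b t \<omega>)\<^sup>2 \<partial>M) +
        exp (V / 2) * c * (\<integral>\<omega>. (b (Suc m) \<omega>)\<^sup>2 \<partial>M)"
    proof (rule order_trans[OF norm_triangle_ineq add_mono])
      show "cmod ((CLINT \<omega>|M. Y m \<omega>) - 1) \<le> exp (V / 2) * c * (\<Sum>t=1..m. \<integral>\<omega>. (b t \<omega>)\<^sup>2 \<partial>M)"
        using Suc by simp
      show "cmod (CLINT \<omega>|M. Y (Suc m) \<omega> - Y m \<omega>) \<le> exp (V / 2) * c * (\<integral>\<omega>. (b (Suc m) \<omega>)\<^sup>2 \<partial>M)"
        unfolding diff c_def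
        by (rule char_one_step_bound[OF _ D_F DC])
           (use b[of "Suc m"] b\<eta>[of "Suc m"] bk[of "Suc m"] k R Suc.prems in auto)
    qed
    also have "\<dots> = exp (V / 2) * c * (\<Sum>t=1..Suc m. \<integral>\<omega>. (b t \<omega>)\<^sup>2 \<partial>M)"
      by (simp add: algebra_simps)
    finally show ?case .
  qed
  have "(\<Sum>t=1..n. \<integral>\<omega>. (b t \<omega>)\<^sup>2 \<partial>M) = (\<integral>\<omega>. (\<Sum>t=1..n. (b t \<omega>)\<^sup>2) \<partial>M)"
    using intb by (intro Bochner_Integration.integral_sum[symmetric]) auto
  also have "\<dots> \<le> (\<integral>\<omega>. V \<partial>M)"
    using intb bV by (intro integral_mono Bochner_Integration.integrable_sum) auto
  finally have "(\<Sum>t=1..n. \<integral>\<omega>. (b t \<omega>)\<^sup>2 \<partial>M) \<le> V" by (simp add: prob_space)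
  then have "exp (V / 2) * c * (\<Sum>t=1..n. \<integral>\<omega>. (b t \<omega>)\<^sup>2 \<partial>M) \<le> exp (V / 2) * c * V"
    using c by (intro mult_left_mono) auto
  from order_trans[OF ind[OF order_refl] this] show ?thesis unfolding Y_def S_def Q_def c_def .
qed

end

section \<open>The limit characteristic function of the martingale\<close>

lemma abs_exp_minus_one_le: "\<bar>x\<bar> \<le> 1 / 2 \<Longrightarrow> \<bar>exp x - 1\<bar> \<le> 2 * \<bar>x\<bar>" for x :: real
proof -
  assume "\<bar>x\<bar> \<le> 1 / 2"
  then have "exp x \<le> 1 + 2 * \<bar>x\<bar>" using exp_bound_lemma[of x] by simp
  moreover have "1 + x \<le> exp x" by (rule exp_ge_add_one_self)
  ultimately show ?thesis by linarith
qed

text \<open>With \<open>Y\<close> the compensated exponential of the truncated martingale,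
  \<open>exp (- s / 2) * Y\<close> has expectation close to \<open>exp (- s / 2)\<close> and agrees
  with the original exponential up to a small error outside rare events. The constants are chosen in
  the order \<open>k\<close>, \<open>R\<close>, \<open>\<eta>\<close>, each depending on the
  previous ones.\<close>

theorem (in unit_noise) martingale_clt_char:
  fixes a :: "nat \<Rightarrow> nat \<Rightarrow> 'a \<Rightarrow> real"
  assumes a: "\<And>n t. 1 \<le> t \<Longrightarrow> t \<le> n \<Longrightarrow> a n t \<in> borel_measurable (F (t - 1))"
    and sup: "AE \<omega> in M. (SUP t\<in>{1..}. cond_moment t \<omega>) < \<infinity>"
    and small: "\<And>c. 0 < c \<Longrightarrow> (\<lambda>n. prob {\<omega> \<in> space M. \<exists>t\<in>{1..n}. \<bar>a n t \<omega>\<bar> > c}) \<longlonglongrightarrow> 0"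
    and var: "\<And>c. 0 < c \<Longrightarrow> (\<lambda>n. prob {\<omega> \<in> space M. \<bar>(\<Sum>t=1..n. (a n t \<omega>)\<^sup>2) - s\<bar> > c}) \<longlonglongrightarrow> 0"
    and s: "0 \<le> s"
  shows "(\<lambda>n. CLINT \<omega>|M. iexp (\<Sum>t=1..n. a n t \<omega> * e t \<omega>)) \<longlonglongrightarrow> complex_of_real (exp (- s / 2))"
  unfolding tendsto_iff dist_norm
proof (intro allI impI)
  fix \<zeta> :: real assume \<zeta>: "0 < \<zeta>"
  \<comment> \<open>On the good event the sum of squares is within \<open>z \<le> 1\<close> of
    \<open>s\<close>, so the truncation at level \<open>V\<close> does nothing there.\<close>
  define V where "V = s + 1"
  have V: "0 < V" using s by (simp add: V_def)
  have cm_F: "cond_moment t \<in> borel_measurable (F (t - 1))" for t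
    unfolding cond_moment_def by (rule borel_measurable_nn_cond_exp)
  have [measurable]: "cond_moment t \<in> borel_measurable M" for t
    using cm_F by (rule measurable_F_M)

  \<comment> \<open>The supremum is only almost surely finite, so a deterministic level
    \<open>k\<close> holds outside a small event. The three bad events have weight 3 each, which
    makes \<open>3 * \<zeta> / 8\<close> in total from the bounds \<open>\<zeta> / 24\<close>;
    \<open>z\<close> and the two Taylor terms add at most \<open>3 * \<zeta> / 8\<close>.\<close>
  obtain k :: real where k: "0 \<le> k" "prob {\<omega> \<in> space M. (SUP t\<in>{1..}. cond_moment t \<omega>) > ennreal k} < \<zeta> / 24"
  proof -
    define A where "A j = {\<omega> \<in> space M. (SUP t\<in>{1..}. cond_moment t \<omega>) > ennreal (real j)}" for j
    have [measurable]: "A j \<in> sets M" for j unfolding A_def by measurable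
    have "decseq A"
      unfolding A_def decseq_def by (auto intro: le_less_trans[rotated] ennreal_leI)
    then have "(\<lambda>j. prob (A j)) \<longlonglongrightarrow> prob (\<Inter>j. A j)"
      by (intro finite_Lim_measure_decseq) auto
    moreover have "prob (\<Inter>j. A j) = 0"
    proof -
      have "AE \<omega> in M. \<omega> \<notin> (\<Inter>j. A j)"
        using sup
      proof eventually_elim
        case (elim \<omega>)
        then obtain r where "(SUP t\<in>{1..}. cond_moment t \<omega>) = ennreal r" "0 \<le> r"
          by (metis ennreal_cases infinity_ennreal_def less_irrefl)
        moreover obtain j :: nat where "r \<le> real j" using real_arch_simple by blast
        ultimately have "\<omega> \<notin> A j" by (auto simp: A_def not_less intro: ennreal_leI)
        then show ?case by auto
      qed
      then show ?thesis by (simp add: prob_eq_0)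
    qed
    ultimately have "\<forall>\<^sub>F j in sequentially. prob (A j) < \<zeta> / 24"
      using \<zeta> by (intro order_tendstoD) auto
    then obtain j where "prob (A j) < \<zeta> / 24" by (auto simp: eventually_sequentially)
    then show ?thesis by (intro that[of "real j"]) (auto simp: A_def)
  qed
  \<comment> \<open>\<open>R\<close> is taken large to beat the moment level \<open>k\<close>; only
    then is \<open>\<eta>\<close> taken small to beat \<open>R\<close>.\<close>
  define C where "C = exp (V / 2) * V"
  have "((\<lambda>R. C * (k * R powr - \<delta>)) \<longlongrightarrow> C * (k * 0)) at_top"
    by (intro tendsto_intros tendsto_neg_powr filterlim_ident) (use \<delta>_pos in auto)
  then have "\<forall>\<^sub>F R in at_top. C * (k * R powr - \<delta>) < \<zeta> / 8"
    using \<zeta> by (intro order_tendstoD) auto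
  with eventually_gt_at_top[of 0] have "\<forall>\<^sub>F R in at_top. 0 < R \<and> C * (k * R powr - \<delta>) < \<zeta> / 8"
    by eventually_elim auto
  then obtain R where R: "0 < R" "C * (k * R powr - \<delta>) < \<zeta> / 8"
    using eventually_happens trivial_limit_at_top_linorder by blast
  have "((\<lambda>\<eta>. C * (\<eta> * R + \<eta>\<^sup>2)) \<longlongrightarrow> C * (0 * R + 0\<^sup>2)) (at_right 0)"
    by (intro tendsto_intros)
  then have "\<forall>\<^sub>F \<eta> in at_right 0. C * (\<eta> * R + \<eta>\<^sup>2) < \<zeta> / 8"
    using \<zeta> by (intro order_tendstoD) auto
  with eventually_at_right_less[of 0] have "\<forall>\<^sub>F \<eta> in at_right 0. 0 < \<eta> \<and> C * (\<eta> * R + \<eta>\<^sup>2) < \<zeta> / 8"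
    by eventually_elim auto
  then obtain \<eta> where \<eta>: "0 < \<eta>" "C * (\<eta> * R + \<eta>\<^sup>2) < \<zeta> / 8"
    using eventually_happens trivial_limit_at_right_real by blast
  define z where "z = min 1 (\<zeta> / 8)"
  have z: "0 < z" "z \<le> 1" "z \<le> \<zeta> / 8" using \<zeta> by (auto simp: z_def)

  define E1 where "E1 n = {\<omega> \<in> space M. \<exists>t\<in>{1..n}. \<bar>a n t \<omega>\<bar> > \<eta>}" for n
  define E2 where "E2 n = {\<omega> \<in> space M. \<bar>(\<Sum>t=1..n. (a n t \<omega>)\<^sup>2) - s\<bar> > z}" for n
  define E3 where "E3 = {\<omega> \<in> space M. (SUP t\<in>{1..}. cond_moment t \<omega>) > ennreal k}"
  have a_M: "a n t \<in> borel_measurable M" if "t \<in> {1..n}" for n t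
    using a[of t n] that by (auto intro: measurable_F_M)
  have Q_M: "(\<lambda>\<omega>. \<Sum>t=1..n. (a n t \<omega>)\<^sup>2) \<in> borel_measurable M" for n
    by (intro borel_measurable_sum borel_measurable_power a_M)
  have S_M: "(\<lambda>\<omega>. \<Sum>t=1..n. a n t \<omega> * e t \<omega>) \<in> borel_measurable M" for n
    by (intro borel_measurable_sum borel_measurable_times a_M e_meas) auto
  have [measurable]: "E1 n \<in> sets M" "E2 n \<in> sets M" "E3 \<in> sets M" for n
  proof -
    note [measurable] = a_M Q_M
    show "E1 n \<in> sets M" unfolding E1_def by measurable
    show "E2 n \<in> sets M" unfolding E2_def by measurable
    show "E3 \<in> sets M" unfolding E3_def by measurable
  qed
  have "\<forall>\<^sub>F n in sequentially. prob (E1 n) < \<zeta> / 24" "\<forall>\<^sub>F n in sequentially. prob (E2 n) < \<zeta> / 24"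
    unfolding E1_def E2_def using small[OF \<eta>(1)] var[OF z(1)] \<zeta> by (auto intro!: order_tendstoD)
  then show "\<forall>\<^sub>F n in sequentially.
    cmod ((CLINT \<omega>|M. iexp (\<Sum>t=1..n. a n t \<omega> * e t \<omega>)) - complex_of_real (exp (- s / 2))) < \<zeta>"
  proof eventually_elim
    case (elim n)
    \<comment> \<open>\<open>G t\<close> depends only on data known at time \<open>t - 1\<close> and decreases in \<open>t\<close>, so the truncated weights
      stay predictable and their squares never sum to more than \<open>V\<close>.\<close>
    define G where "G t \<omega> \<longleftrightarrow> (\<Sum>r=1..t. (a n r \<omega>)\<^sup>2) \<le> V \<and>
      (\<forall>r\<in>{1..t}. \<bar>a n r \<omega>\<bar> \<le> \<eta> \<and> cond_moment r \<omega> \<le> ennreal k)" for t \<omega>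
    define b where "b t \<omega> = (if G t \<omega> then a n t \<omega> else 0)" for t \<omega>
    have G_anti: "G r \<omega>" if "G t \<omega>" "r \<le> t" for r t \<omega>
    proof -
      have "(\<Sum>r=1..r. (a n r \<omega>)\<^sup>2) \<le> (\<Sum>r=1..t. (a n r \<omega>)\<^sup>2)"
        using that(2) by (intro sum_mono2) auto
      then show ?thesis using that unfolding G_def by auto
    qed
    have b_F: "b t \<in> borel_measurable (F (t - 1))" if t: "1 \<le> t" "t \<le> n" for t
    proof -
      have a_F: "a n r \<in> borel_measurable (F (t - 1))" if "r \<in> {1..t}" for r
        using that t by (intro measurable_F_mono[OF _ a]) auto
      have cmt_F: "cond_moment r \<in> borel_measurable (F (t - 1))" if "r \<in> {1..t}" for r
        using that by (intro measurable_F_mono[OF _ cm_F]) auto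
      have [measurable]: "(\<lambda>\<omega>. \<Sum>r=1..t. (a n r \<omega>)\<^sup>2) \<in> borel_measurable (F (t - 1))"
        by (intro borel_measurable_sum borel_measurable_power a_F)
      note [measurable] = a_F cmt_F
      have [measurable]: "Measurable.pred (F (t - 1)) (G t)"
        unfolding G_def by measurable
      have [measurable]: "a n t \<in> borel_measurable (F (t - 1))" using t by (intro a_F) auto
      show ?thesis unfolding b_def by measurable
    qed
    have b_bounds: "\<bar>b t \<omega>\<bar> \<le> \<eta>" "b t \<omega> \<noteq> 0 \<Longrightarrow> cond_moment t \<omega> \<le> ennreal k" if "1 \<le> t" for t \<omega>
      using that \<eta>(1) by (auto simp: b_def G_def split: if_splits)
    \<comment> \<open>If \<open>G (Suc m) \<omega>\<close> holds, no weight up to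
      \<open>Suc m\<close> has been truncated and the bound is part of \<open>G\<close>; otherwise
      the new term is zero.\<close>
    have bV: "(\<Sum>t=1..m. (b t \<omega>)\<^sup>2) \<le> V" for m \<omega>
    proof (induction m)
      case (Suc m)
      show ?case
      proof (cases "G (Suc m) \<omega>")
        case True
        then have "(\<Sum>t=1..Suc m. (b t \<omega>)\<^sup>2) = (\<Sum>t=1..Suc m. (a n t \<omega>)\<^sup>2)"
          by (intro sum.cong) (auto simp: b_def dest: G_anti)
        then show ?thesis using True by (simp add: G_def)
      next
        case False
        then show ?thesis using Suc by (simp add: b_def)
      qed
    qed (use V in simp)
    define Sa where "Sa \<omega> = (\<Sum>t=1..n. a n t \<omega> * e t \<omega>)" for \<omega>
    define Sb where "Sb \<omega> = (\<Sum>t=1..n. b t \<omega> * e t \<omega>)" for \<omega>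
    define Q where "Q \<omega> = (\<Sum>t=1..n. (b t \<omega>)\<^sup>2)" for \<omega>
    define Y where "Y \<omega> = iexp (Sb \<omega>) * complex_of_real (exp (Q \<omega> / 2))" for \<omega>
    have [measurable]: "Sa \<in> borel_measurable M" unfolding Sa_def by (rule S_M)
    have [measurable]: "Sb \<in> borel_measurable M" unfolding Sb_def
      by (intro borel_measurable_sum borel_measurable_times measurable_F_M[OF b_F] e_meas) auto
    have [measurable]: "Q \<in> borel_measurable M" unfolding Q_def
      by (intro borel_measurable_sum borel_measurable_power measurable_F_M[OF b_F]) auto
    have Q_le: "Q \<omega> \<le> V" for \<omega> unfolding Q_def by (rule bV)
    have intY: "integrable M Y"
    proof (rule integrable_const_bound[of _ "exp (V / 2)"])
      show "AE \<omega> in M. cmod (Y \<omega>) \<le> exp (V / 2)"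
        unfolding Y_def norm_mult using Q_le by (intro AE_I2) simp
      show "Y \<in> borel_measurable M" unfolding Y_def by measurable
    qed
    have intSa: "integrable M (\<lambda>\<omega>. iexp (Sa \<omega>))" by (auto intro!: integrable_iexp)
    have EY: "cmod ((CLINT \<omega>|M. Y \<omega>) - 1) \<le> exp (V / 2) * (\<eta> * R + k * R powr - \<delta> + \<eta>\<^sup>2) * V"
      unfolding Y_def Sb_def Q_def
      by (rule char_martingale_bound)
         (use b_F b_bounds bV k R \<eta> in auto)
    define q where "q = complex_of_real (exp (- s / 2))"
    have q: "cmod q \<le> 1" using s by (simp add: q_def)
    \<comment> \<open>On a bad event the crude bound 3 comes from
      \<open>1 + exp (1 / 2) \<le> 3\<close>, using that the truncated sum of squares never exceeds
      \<open>s + 1\<close>. Elsewhere nothing is truncated and only the factor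
      \<open>exp ((Q \<omega> - s) / 2)\<close> differs from 1.\<close>
    have point: "cmod (iexp (Sa \<omega>) - q * Y \<omega>) \<le> z + (3 * indicator (E1 n) \<omega> + (3 * indicator (E2 n) \<omega> + 3 * indicator E3 \<omega>))"
      if \<omega>: "\<omega> \<in> space M" for \<omega>
    proof -
      have qY: "q * Y \<omega> = iexp (Sb \<omega>) * complex_of_real (exp ((Q \<omega> - s) / 2))"
      proof -
        have "exp ((Q \<omega> - s) / 2) = exp (- s / 2) * exp (Q \<omega> / 2)"
          by (simp add: diff_divide_distrib flip: exp_add)
        then show ?thesis by (simp only: q_def Y_def of_real_mult mult_ac)
      qed
      show ?thesis
      proof (cases "\<omega> \<in> E1 n \<or> \<omega> \<in> E2 n \<or> \<omega> \<in> E3")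
        case True
        have "cmod (iexp (Sa \<omega>) - q * Y \<omega>) \<le> 1 + exp ((Q \<omega> - s) / 2)"
          unfolding qY by (rule order_trans[OF norm_triangle_ineq4]) (simp add: norm_mult)
        also have "exp ((Q \<omega> - s) / 2) \<le> exp (1 / 2)" using Q_le[of \<omega>] by (simp add: V_def)
        also have "exp (1 / 2) \<le> (2::real)" using exp_bound_lemma[of "1 / 2 :: real"] by simp
        finally have "cmod (iexp (Sa \<omega>) - q * Y \<omega>) \<le> 3" by simp
        moreover have "3 \<le> 3 * indicator (E1 n) \<omega> + (3 * indicator (E2 n) \<omega> + 3 * (indicator E3 \<omega> :: real))"
          using True by (auto simp: indicator_def)
        ultimately show ?thesis using z by linarith
      next
        case False
        then have 1: "\<And>t. t \<in> {1..n} \<Longrightarrow> \<bar>a n t \<omega>\<bar> \<le> \<eta>"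
          and 2: "\<bar>(\<Sum>t=1..n. (a n t \<omega>)\<^sup>2) - s\<bar> \<le> z"
          and 3: "(SUP t\<in>{1..}. cond_moment t \<omega>) \<le> ennreal k"
          using \<omega> by (auto simp: E1_def E2_def E3_def not_less)
        have "G n \<omega>"
          unfolding G_def using 1 2 3 z by (auto simp: V_def SUP_le_iff)
        then have ba: "b t \<omega> = a n t \<omega>" if "t \<in> {1..n}" for t
          using that G_anti[of n \<omega> t] by (simp add: b_def)
        then have "Sb \<omega> = Sa \<omega>" by (simp add: Sa_def Sb_def)
        have "Q \<omega> = (\<Sum>t=1..n. (a n t \<omega>)\<^sup>2)" using ba by (simp add: Q_def)
        with 2 have Qs: "\<bar>Q \<omega> - s\<bar> \<le> z" by simp
        have "iexp (Sa \<omega>) - q * Y \<omega> = iexp (Sa \<omega>) * complex_of_real (1 - exp ((Q \<omega> - s) / 2))"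
          unfolding qY \<open>Sb \<omega> = Sa \<omega>\<close> by (simp only: of_real_diff of_real_1 algebra_simps mult_1)
        then have "cmod (iexp (Sa \<omega>) - q * Y \<omega>) = \<bar>1 - exp ((Q \<omega> - s) / 2)\<bar>"
          by (simp only: norm_mult norm_of_real norm_exp_i_times mult_1)
        also have "\<dots> \<le> 2 * \<bar>(Q \<omega> - s) / 2\<bar>"
          using abs_exp_minus_one_le[of "(Q \<omega> - s) / 2"] Qs z by (simp add: abs_minus_commute)
        also have "\<dots> \<le> z" using Qs by simp
        finally show ?thesis using False by simp
      qed
    qed
    have "cmod ((CLINT \<omega>|M. iexp (Sa \<omega>)) - q) \<le>
        cmod (CLINT \<omega>|M. iexp (Sa \<omega>) - q * Y \<omega>) + cmod (q * ((CLINT \<omega>|M. Y \<omega>) - 1))"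
    proof -
      have "(CLINT \<omega>|M. iexp (Sa \<omega>)) - q = (CLINT \<omega>|M. iexp (Sa \<omega>) - q * Y \<omega>) + q * ((CLINT \<omega>|M. Y \<omega>) - 1)"
        using intSa intY by (simp add: algebra_simps)
      then show ?thesis by (simp only: norm_triangle_ineq)
    qed
    also have "cmod (CLINT \<omega>|M. iexp (Sa \<omega>) - q * Y \<omega>) \<le> (\<integral>\<omega>. cmod (iexp (Sa \<omega>) - q * Y \<omega>) \<partial>M)"
      by (rule integral_norm_bound)
    also have "\<dots> \<le> (\<integral>\<omega>. z + (3 * indicator (E1 n) \<omega> + (3 * indicator (E2 n) \<omega> + 3 * indicator E3 \<omega>)) \<partial>M)"
      using point intSa intY by (intro integral_mono) (auto simp: emeasure_eq_measure)
    also have "\<dots> = z + (3 * prob (E1 n) + (3 * prob (E2 n) + 3 * prob E3))"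
      by (simp add: emeasure_eq_measure prob_space)
    also have "cmod (q * ((CLINT \<omega>|M. Y \<omega>) - 1)) \<le> 1 * (exp (V / 2) * (\<eta> * R + k * R powr - \<delta> + \<eta>\<^sup>2) * V)"
      unfolding norm_mult by (intro mult_mono q EY) auto
    also have "\<dots> = C * (\<eta> * R + \<eta>\<^sup>2) + C * (k * R powr - \<delta>)"
      by (simp add: C_def algebra_simps)
    finally have "cmod ((CLINT \<omega>|M. iexp (Sa \<omega>)) - q) < \<zeta>"
      using elim z R(2) \<eta>(2) k(2)[folded E3_def] \<zeta> by simp
    then show ?case unfolding Sa_def q_def .
  qed
qed

section \<open>The estimating equation\<close>

lemma transpose_mult_vector:
  "transpose_mult n P Q *v d = (\<Sum>t=1..n. (Q t \<bullet> d) *\<^sub>R P t)"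
  unfolding vec_eq_iff
proof
  fix i
  have "(transpose_mult n P Q *v d) $ i = (\<Sum>j\<in>UNIV. \<Sum>t=1..n. P t $ i * Q t $ j * d $ j)"
    by (simp add: transpose_mult_def matrix_vector_mult_def sum_distrib_right)
  also have "\<dots> = (\<Sum>t=1..n. \<Sum>j\<in>UNIV. P t $ i * Q t $ j * d $ j)" by (rule sum.swap)
  also have "\<dots> = (\<Sum>t=1..n. (Q t \<bullet> d) *\<^sub>R P t) $ i"
    by (simp add: inner_vec_def sum_distrib_left sum_distrib_right mult_ac)
  finally show "(transpose_mult n P Q *v d) $ i = (\<Sum>t=1..n. (Q t \<bullet> d) *\<^sub>R P t) $ i" .
qed

lemma norm_orthogonal_matrix_mult: "orthogonal_matrix V \<Longrightarrow> norm (V *v z) = norm z" for V :: "real^'d^'d"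
  using orthogonal_transformation_matrix[of "(*v) V"] orthogonal_transformation_norm[of "(*v) V" z]
  by (simp add: matrix_vector_mul_linear matrix_of_matrix_vector_mul)

text \<open>Everything is diagonal in the frame \<open>V\<close>: with
  \<open>p = transpose_mult n U x *v d\<close>, the three vectors are \<open>Z = V p\<close>, the
  score \<open>V \<Lambda> p\<close>, and \<open>(mat 1 - transpose_mult n W W) Z = V (p - \<Lambda>
  \<Lambda> p)\<close>. Since \<open>V\<close> preserves norms, they can be compared entry by
  entry.\<close>

lemma thin_svd_estimating_equation:
  fixes W U :: "nat \<Rightarrow> real^'d" and x :: "nat \<Rightarrow> real^'e"
  assumes svd: "is_thin_svd n W U \<Lambda> V"
    and est: "(\<Sum>t=1..n. (e t - x t \<bullet> d) *\<^sub>R W t) = 0"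
  defines "Z \<equiv> (V ** transpose_mult n U x) *v d"
  shows "norm (Z - (\<Sum>t=1..n. e t *\<^sub>R W t)) \<le> onorm ((*v) (mat 1 - transpose_mult n W W)) * norm Z"
proof -
  have UU: "transpose_mult n U U = mat 1" and off: "\<And>i j. i \<noteq> j \<Longrightarrow> \<Lambda> $ i $ j = 0"
    and pos: "\<And>i. 0 \<le> \<Lambda> $ i $ i" and V: "orthogonal_matrix V"
    and W: "\<And>t. t \<in> {1..n} \<Longrightarrow> W t = U t v* (\<Lambda> ** transpose V)"
    using svd by (auto simp: is_thin_svd_def)
  have \<Lambda>T: "transpose \<Lambda> = \<Lambda>"
    unfolding vec_eq_iff transpose_def using off by (metis vec_lambda_beta)
  have \<Lambda>v: "(\<Lambda> *v q) $ i = \<Lambda> $ i $ i * q $ i" for q i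
  proof -
    have "(\<Sum>j\<in>UNIV. \<Lambda> $ i $ j * q $ j) = (\<Sum>j\<in>UNIV. if j = i then \<Lambda> $ i $ i * q $ i else 0)"
      by (rule sum.cong) (auto simp: off)
    then show ?thesis by (simp add: matrix_vector_mult_def)
  qed
  have Wt: "W t = V *v (\<Lambda> *v U t)" if "t \<in> {1..n}" for t
  proof -
    have "W t = transpose (\<Lambda> ** transpose V) *v U t" using W[OF that] by simp
    then show ?thesis by (simp add: matrix_transpose_mul \<Lambda>T matrix_vector_mul_assoc del: transpose_matrix_vector)
  qed
  have WU: "(\<Sum>t=1..n. c t *\<^sub>R W t) = V *v (\<Lambda> *v (\<Sum>t=1..n. c t *\<^sub>R U t))" for c
  proof -
    have "V *v (\<Lambda> *v (\<Sum>t=1..n. c t *\<^sub>R U t)) = (\<Sum>t=1..n. (V ** \<Lambda>) *v (c t *\<^sub>R U t))"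
      by (simp only: matrix_vector_mul_assoc linear_sum[OF matrix_vector_mul_linear])
    also have "\<dots> = (\<Sum>t=1..n. c t *\<^sub>R W t)"
      by (rule sum.cong) (simp_all add: Wt matrix_vector_mult_scaleR matrix_vector_mul_assoc)
    finally show ?thesis ..
  qed
  define p where "p = transpose_mult n U x *v d"
  have Z: "Z = V *v p" by (simp add: Z_def p_def matrix_vector_mul_assoc)
  have S: "(\<Sum>t=1..n. e t *\<^sub>R W t) = V *v (\<Lambda> *v p)"
  proof -
    have "(\<Sum>t=1..n. e t *\<^sub>R W t) = (\<Sum>t=1..n. (x t \<bullet> d) *\<^sub>R W t)"
      using est by (simp add: scaleR_diff_left sum_subtractf)
    also have "\<dots> = V *v (\<Lambda> *v p)" by (simp only: WU p_def transpose_mult_vector)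
    finally show ?thesis .
  qed
  have inner_W: "W t \<bullet> Z = U t \<bullet> (\<Lambda> *v p)" if "t \<in> {1..n}" for t
  proof -
    have "W t \<bullet> Z = U t \<bullet> ((\<Lambda> ** transpose V) *v (V *v p))" by (simp add: W[OF that] Z dot_lmul_matrix)
    also have "(\<Lambda> ** transpose V) *v (V *v p) = \<Lambda> *v ((transpose V ** V) *v p)"
      by (simp only: matrix_vector_mul_assoc matrix_mul_assoc)
    also have "\<dots> = \<Lambda> *v p" using V by (simp add: orthogonal_matrix)
    finally show ?thesis .
  qed
  have "transpose_mult n W W *v Z = (\<Sum>t=1..n. (U t \<bullet> (\<Lambda> *v p)) *\<^sub>R W t)"
    unfolding transpose_mult_vector by (intro sum.cong refl) (simp add: inner_W)
  also have "\<dots> = V *v (\<Lambda> *v (transpose_mult n U U *v (\<Lambda> *v p)))" unfolding WU transpose_mult_vector ..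
  finally have WW: "(mat 1 - transpose_mult n W W) *v Z = V *v (p - \<Lambda> *v (\<Lambda> *v p))"
    by (simp add: UU Z matrix_vector_mult_diff_rdistrib matrix_vector_mult_diff_distrib)
  have "norm (Z - (\<Sum>t=1..n. e t *\<^sub>R W t)) = norm (V *v (p - \<Lambda> *v p))"
    by (simp only: Z S matrix_vector_mult_diff_distrib)
  also have "\<dots> = norm (p - \<Lambda> *v p)" by (rule norm_orthogonal_matrix_mult[OF V])
  also have "\<dots> \<le> norm (p - \<Lambda> *v (\<Lambda> *v p))"
  proof (rule norm_le_componentwise_cart)
    fix i
    let ?l = "\<Lambda> $ i $ i"
    \<comment> \<open>Singular values are nonnegative, so the factor \<open>1 + ?l\<close> is at
      least 1.\<close>
    have "\<bar>1 - ?l\<bar> * 1 \<le> \<bar>1 - ?l\<bar> * (1 + ?l)" using pos[of i] by (intro mult_left_mono) auto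
    also have "\<dots> = \<bar>(1 - ?l) * (1 + ?l)\<bar>" using pos[of i] by (simp add: abs_mult)
    finally have "\<bar>1 - ?l\<bar> * \<bar>p $ i\<bar> \<le> \<bar>(1 - ?l) * (1 + ?l)\<bar> * \<bar>p $ i\<bar>" by (intro mult_right_mono) auto
    then show "norm ((p - \<Lambda> *v p) $ i) \<le> norm ((p - \<Lambda> *v (\<Lambda> *v p)) $ i)"
      by (simp add: \<Lambda>v algebra_simps flip: abs_mult)
  qed
  also have "\<dots> = norm ((mat 1 - transpose_mult n W W) *v Z)"
    by (simp add: WW norm_orthogonal_matrix_mult[OF V])
  also have "\<dots> \<le> onorm ((*v) (mat 1 - transpose_mult n W W)) * norm Z"
    by (rule onorm[OF matrix_vector_mul_bounded_linear])
  finally show ?thesis .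
qed

text \<open>The bound is implicit in \<open>Z\<close>; since \<open>c \<le> 1 / 2\<close>, the error
  can be absorbed to give \<open>norm (Z - S) \<le> 2 * c * norm S\<close>. Also
  \<open>\<tau> \<ge> \<sigma> / 2\<close>, so replacing \<open>Z\<close> by \<open>S\<close>
  contributes \<open>4 * c\<close> and replacing \<open>\<tau>\<close> by \<open>\<sigma>\<close>
  contributes \<open>2 * c\<close>.\<close>

lemma studentization_perturbation:
  fixes Z S :: "'b::real_normed_vector"
  assumes Z: "norm (Z - S) \<le> r * norm Z" and r: "r \<le> c" and c: "0 < c" "c \<le> 1 / 2"
    and \<sigma>: "0 < \<sigma>" and \<tau>: "\<bar>\<tau> - \<sigma>\<bar> \<le> c * \<sigma>"
  shows "norm (Z /\<^sub>R \<tau> - S /\<^sub>R \<sigma>) \<le> 6 * c * norm (S /\<^sub>R \<sigma>)"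
proof -
  have "norm Z \<le> norm (Z - S) + norm S" using norm_triangle_ineq[of "Z - S" S] by simp
  then have "c * norm Z \<le> c * norm (Z - S) + c * norm S"
    using c by (simp add: mult_left_mono flip: distrib_left)
  moreover have "c * norm (Z - S) \<le> 1 / 2 * norm (Z - S)" using c by (intro mult_right_mono) auto
  moreover have "r * norm Z \<le> c * norm Z" using r by (intro mult_right_mono) auto
  ultimately have ZS: "norm (Z - S) \<le> 2 * c * norm S" using Z by linarith
  have "c * \<sigma> \<le> 1 / 2 * \<sigma>" using c \<sigma> by (intro mult_right_mono) auto
  then have \<tau>2: "\<sigma> / 2 \<le> \<tau>" using \<tau> by linarith
  then have \<tau>0: "0 < \<tau>" using \<sigma> by linarith
  have inv: "inverse \<tau> \<le> 2 / \<sigma>" using \<tau>2 \<tau>0 \<sigma> by (simp add: field_simps)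
  have "inverse \<tau> - inverse \<sigma> = (\<sigma> - \<tau>) * inverse \<tau> / \<sigma>"
    using \<sigma> \<tau>0 by (simp add: field_simps)
  then have "\<bar>inverse \<tau> - inverse \<sigma>\<bar> = \<bar>\<tau> - \<sigma>\<bar> * inverse \<tau> / \<sigma>"
    using \<sigma> \<tau>0 by (simp add: abs_mult abs_minus_commute)
  also have "\<dots> \<le> (c * \<sigma>) * (2 / \<sigma>) / \<sigma>"
    using \<tau> inv \<tau>0 \<sigma> c by (intro divide_right_mono mult_mono) auto
  also have "\<dots> = 2 * c / \<sigma>" using \<sigma> by simp
  finally have diff: "\<bar>inverse \<tau> - inverse \<sigma>\<bar> \<le> 2 * c / \<sigma>" .
  have "Z /\<^sub>R \<tau> - S /\<^sub>R \<sigma> = (Z - S) /\<^sub>R \<tau> + (inverse \<tau> - inverse \<sigma>) *\<^sub>R S"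
    by (simp add: algebra_simps)
  also have "norm \<dots> \<le> inverse \<tau> * norm (Z - S) + \<bar>inverse \<tau> - inverse \<sigma>\<bar> * norm S"
    using \<tau>0 by (intro order_trans[OF norm_triangle_ineq]) simp
  also have "\<dots> \<le> (2 / \<sigma>) * (2 * c * norm S) + 2 * c / \<sigma> * norm S"
    using inv ZS diff \<sigma> by (intro add_mono mult_mono) auto
  also have "\<dots> = 6 * c * norm (S /\<^sub>R \<sigma>)" using \<sigma> by (simp add: field_simps)
  finally show ?thesis .
qed

text \<open>The inclusion is eventual and almost sure because the decomposition and the estimating
  equation are available only almost surely and for \<open>n\<close> at least the dimension.\<close>

lemma (in prob_space) prob_tendsto_zero_mono_AE:
  assumes "\<forall>\<^sub>F n in sequentially. AE \<omega> in M. \<omega> \<in> A n \<longrightarrow> \<omega> \<in> B n"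
    and "\<And>n. B n \<in> sets M" and "(\<lambda>n. prob (B n)) \<longlonglongrightarrow> 0"
  shows "(\<lambda>n. prob (A n)) \<longlonglongrightarrow> 0"
proof (rule tendsto_sandwich[OF _ _ tendsto_const assms(3)])
  show "\<forall>\<^sub>F n in sequentially. prob (A n) \<le> prob (B n)"
    using assms(1) by eventually_elim (intro finite_measure_mono_AE assms(2))
qed simp

lemma borel_measurable_matrix_vector_mult [measurable (raw)]:
  fixes A :: "'a \<Rightarrow> real^'n^'m"
  assumes [measurable]: "A \<in> borel_measurable M" "v \<in> borel_measurable M"
  shows "(\<lambda>\<omega>. A \<omega> *v v \<omega>) \<in> borel_measurable M"
proof (subst borel_measurable_euclidean_space, intro ballI)
  fix b :: "real^'m" assume "b \<in> Basis"
  then obtain i where b: "b = axis i 1" by (auto simp: Basis_vec_def)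
  have "(\<lambda>\<omega>. \<Sum>j\<in>UNIV. (A \<omega> \<bullet> axis i (axis j 1)) * (v \<omega> \<bullet> axis j 1)) \<in> borel_measurable M"
    by (intro borel_measurable_sum borel_measurable_times borel_measurable_inner) auto
  then show "(\<lambda>\<omega>. (A \<omega> *v v \<omega>) \<bullet> b) \<in> borel_measurable M"
    by (simp add: b inner_axis matrix_vector_mult_def)
qed

text \<open>The decomposition and the estimating equation are assumed from
  \<open>n = CARD('d)\<close> on, since fewer rows cannot carry orthonormal columns. The conditional
  moments are taken in \<open>ennreal\<close>, and their supremum over time is finite almost surely,
  with no common deterministic bound.\<close>

theorem proposition2p1:
  fixes M :: "'a measure"
    and F :: "nat \<Rightarrow> 'a measure"
    and x :: "nat \<Rightarrow> 'a \<Rightarrow> real^'d"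
    and y \<epsilon> :: "nat \<Rightarrow> 'a \<Rightarrow> real"
    and \<theta> :: "real^'d"
    and \<sigma> \<delta> :: real
    and w U :: "nat \<Rightarrow> nat \<Rightarrow> 'a \<Rightarrow> real^'d"
    and \<Lambda> V :: "nat \<Rightarrow> 'a \<Rightarrow> real^'d^'d"
    and \<theta>_alee :: "nat \<Rightarrow> 'a \<Rightarrow> real^'d"
    and \<sigma>_hat :: "nat \<Rightarrow> 'a \<Rightarrow> real"
  assumes "prob_space M"
    and "filtration (space M) F"
    and "\<And>t. subalgebra M (F t)"
    and "\<And>s t. 1 \<le> s \<Longrightarrow> s \<le> t \<Longrightarrow> x s \<in> borel_measurable (F (t - 1))"
    and "\<And>s t. 1 \<le> s \<Longrightarrow> s < t \<Longrightarrow> y s \<in> borel_measurable (F (t - 1))"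
    and "\<And>t \<omega>. 1 \<le> t \<Longrightarrow> \<omega> \<in> space M \<Longrightarrow> y t \<omega> = x t \<omega> \<bullet> \<theta> + \<epsilon> t \<omega>"
    and "0 < \<sigma>" and "0 < \<delta>"
    and "\<And>t. 1 \<le> t \<Longrightarrow> integrable M (\<epsilon> t)"
    and "\<And>t. 1 \<le> t \<Longrightarrow> integrable M (\<lambda>\<omega>. (\<epsilon> t \<omega>)\<^sup>2)"
    and "\<And>t. 1 \<le> t \<Longrightarrow> AE \<omega> in M. real_cond_exp M (F (t - 1)) (\<epsilon> t) \<omega> = 0"
    and "\<And>t. 1 \<le> t \<Longrightarrow>
      AE \<omega> in M. real_cond_exp M (F (t - 1)) (\<lambda>\<omega>'. (\<epsilon> t \<omega>')\<^sup>2) \<omega> = \<sigma>\<^sup>2"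
    and "AE \<omega> in M. (SUP t\<in>{1..}. nn_cond_exp M (F (t - 1))
      (\<lambda>\<omega>'. ennreal (\<bar>\<epsilon> t \<omega>' / \<sigma>\<bar> powr (2 + \<delta>))) \<omega>) < \<infinity>"
    and "\<And>n t. 1 \<le> t \<Longrightarrow> t \<le> n \<Longrightarrow> w n t \<in> borel_measurable (F (t - 1))"
    and "tendsto_in_prob M (\<lambda>n \<omega>. Max ((\<lambda>t. norm (w n t \<omega>)) ` {1..n})) 0"
    and "tendsto_in_prob M (\<lambda>n \<omega>. onorm ((*v)
      (mat 1 - transpose_mult n (\<lambda>t. w n t \<omega>) (\<lambda>t. w n t \<omega>)))) 0"
    and "\<And>n t. 1 \<le> t \<Longrightarrow> t \<le> n \<Longrightarrow> U n t \<in> borel_measurable M"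
    and "\<And>n. V n \<in> borel_measurable M"
    and "\<And>n. CARD('d) \<le> n \<Longrightarrow>
      AE \<omega> in M. is_thin_svd n (\<lambda>t. w n t \<omega>) (\<lambda>t. U n t \<omega>) (\<Lambda> n \<omega>) (V n \<omega>)"
    and "\<And>n. \<theta>_alee n \<in> borel_measurable M"
    and "\<And>n. CARD('d) \<le> n \<Longrightarrow>
      AE \<omega> in M. (\<Sum>t=1..n. (y t \<omega> - x t \<omega> \<bullet> \<theta>_alee n \<omega>) *\<^sub>R w n t \<omega>) = 0"
    and "tendsto_in_prob M \<sigma>_hat \<sigma>"
  shows "tendsto_in_distribution M
    (\<lambda>n \<omega>. ((V n \<omega> ** transpose_mult n (\<lambda>t. U n t \<omega>) (\<lambda>t. x t \<omega>)) *v (\<theta>_alee n \<omega> - \<theta>))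
      /\<^sub>R \<sigma>_hat n \<omega>)
    (std_gaussian :: (real^'d) measure)"
proof -
  note prob = assms(1) and filt = assms(2) and sub = assms(3) and x_F = assms(4) and y_F = assms(5)
    and y_eq = assms(6) and \<sigma> = assms(7) and \<delta> = assms(8) and int_\<epsilon> = assms(9) and int_\<epsilon>2 = assms(10)
    and mean = assms(11) and var = assms(12) and moment = assms(13) and w_F = assms(14)
    and w_max = assms(15) and w_op = assms(16) and U_M = assms(17) and V_M = assms(18)
    and svd = assms(19) and \<theta>_M = assms(20) and est = assms(21) and \<sigma>_hat = assms(22)
  interpret prob_space M by (rule prob)
  interpret noise: unit_noise M F "\<lambda>t \<omega>. \<epsilon> t \<omega> / \<sigma>" \<delta>
  proof (standard, goal_cases)
    case (1 t) then show ?case by (rule sub)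
  next
    case (2 s t) then show ?case using filtration.sets_F_mono[OF filt] by blast
  next
    \<comment> \<open>The noise is recovered as \<open>y t - x t \<bullet> \<theta>\<close>. The
      response at time \<open>t\<close> is measurable one step later, hence the instance at
      \<open>Suc t\<close>.\<close>
    case (3 t)
    have [measurable]: "y t \<in> borel_measurable (F t)" "x t \<in> borel_measurable (F t)"
      using y_F[of t "Suc t"] x_F[of t "Suc t"] 3 by auto
    have "(\<lambda>\<omega>. (y t \<omega> - x t \<omega> \<bullet> \<theta>) / \<sigma>) \<in> borel_measurable (F t)" by measurable
    then show ?case
      by (rule measurable_cong[THEN iffD1, rotated])
         (use y_eq[OF 3] filtration.space_F[OF filt] in auto)
  next
    case 4 show ?case by (rule \<delta>)
  next
    case (5 t) then show ?case using int_\<epsilon> by simp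
  next
    case (6 t) then show ?case using int_\<epsilon>2 by (simp add: power_divide)
  next
    case (7 t)
    interpret finite_measure_subalgebra M "F (t - 1)" by unfold_locales (rule sub)
    show ?case using real_cond_exp_cdiv[OF int_\<epsilon>[OF 7], of \<sigma>] mean[OF 7] by eventually_elim simp
  next
    case (8 t)
    interpret finite_measure_subalgebra M "F (t - 1)" by unfold_locales (rule sub)
    show ?case
      using real_cond_exp_cdiv[OF int_\<epsilon>2[OF 8], of "\<sigma>\<^sup>2"] var[OF 8]
      by eventually_elim (use \<sigma> in \<open>simp add: power_divide\<close>)
  qed
  define Z where "Z n \<omega> = (V n \<omega> ** transpose_mult n (\<lambda>t. U n t \<omega>) (\<lambda>t. x t \<omega>)) *v (\<theta>_alee n \<omega> - \<theta>)" for n \<omega>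
  define S where "S n \<omega> = (\<Sum>t=1..n. \<epsilon> t \<omega> *\<^sub>R w n t \<omega>)" for n \<omega>
  define r where "r n \<omega> = onorm ((*v) (mat 1 - transpose_mult n (\<lambda>t. w n t \<omega>) (\<lambda>t. w n t \<omega>)))" for n \<omega>
  define m where "m n \<omega> = Max ((\<lambda>t. norm (w n t \<omega>)) ` {1..n})" for n \<omega>
  have w_M: "w n t \<in> borel_measurable M" if "t \<in> {1..n}" for n t
    using that w_F[of t n] by (auto intro: noise.measurable_F_M)
  have x_M: "x t \<in> borel_measurable M" if "t \<in> {1..n}" for n t
    using that x_F[of t t] by (auto intro: noise.measurable_F_M)
  have [measurable]: "r n \<in> borel_measurable M" "m n \<in> borel_measurable M" "\<sigma>_hat n \<in> borel_measurable M" for n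
    using w_op w_max \<sigma>_hat by (auto simp: tendsto_in_prob_def r_def[abs_def] m_def[abs_def])
  have r_nonneg: "0 \<le> r n \<omega>" for n \<omega>
    unfolding r_def by (rule onorm_pos_le[OF matrix_vector_mul_bounded_linear])
  have r_lim: "(\<lambda>n. prob {\<omega> \<in> space M. r n \<omega> > c}) \<longlonglongrightarrow> 0" if "0 < c" for c
    using w_op that r_nonneg unfolding tendsto_in_prob_def r_def[symmetric] by (simp add: dist_real_def)
  have m_lim: "(\<lambda>n. prob {\<omega> \<in> space M. \<bar>m n \<omega>\<bar> > c}) \<longlonglongrightarrow> 0" if "0 < c" for c
    using w_max that unfolding tendsto_in_prob_def m_def[symmetric] by (simp add: dist_real_def)
  have \<sigma>_lim: "(\<lambda>n. prob {\<omega> \<in> space M. \<bar>\<sigma>_hat n \<omega> - \<sigma>\<bar> > c}) \<longlonglongrightarrow> 0" if "0 < c" for c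
    using \<sigma>_hat that unfolding tendsto_in_prob_def by (simp add: dist_real_def)
  have S_M [measurable]: "S n \<in> borel_measurable M" for n
    unfolding S_def using int_\<epsilon>
    by (intro borel_measurable_sum borel_measurable_scaleR w_M) auto
  have Z_M [measurable]: "Z n \<in> borel_measurable M" for n
  proof -
    note [measurable] = V_M[of n] \<theta>_M[of n]
    have [measurable]: "(\<lambda>\<omega>. \<Sum>t=1..n. (x t \<omega> \<bullet> (\<theta>_alee n \<omega> - \<theta>)) *\<^sub>R U n t \<omega>) \<in> borel_measurable M"
      using U_M by (intro borel_measurable_sum borel_measurable_scaleR borel_measurable_inner x_M) auto
    \<comment> \<open>Written with row sums, \<open>Z\<close> is a measurable matrix applied to a
      measurable vector.\<close>
    have Z_eq: "Z n = (\<lambda>\<omega>. V n \<omega> *v (\<Sum>t=1..n. (x t \<omega> \<bullet> (\<theta>_alee n \<omega> - \<theta>)) *\<^sub>R U n t \<omega>))"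
      by (simp add: Z_def fun_eq_iff transpose_mult_vector flip: matrix_vector_mul_assoc)
    show ?thesis unfolding Z_eq by measurable
  qed
  have char: "(\<lambda>n. CLINT \<omega>|M. iexp (u \<bullet> (S n \<omega> /\<^sub>R \<sigma>))) \<longlonglongrightarrow> (CLINT z|std_gaussian. iexp (u \<bullet> z))" for u
  proof -
    define q where "q = norm u + 1"
    have q: "0 < q" "norm u \<le> q" by (auto simp: q_def intro: add_nonneg_pos)
    \<comment> \<open>Projecting on \<open>u\<close> turns the score into a scalar martingale with
      weights \<open>u \<bullet> w n t \<omega>\<close> and limiting variance
      \<open>(norm u)\<^sup>2\<close>.\<close>
    have "(\<lambda>n. CLINT \<omega>|M. iexp (\<Sum>t=1..n. (u \<bullet> w n t \<omega>) * (\<epsilon> t \<omega> / \<sigma>))) \<longlonglongrightarrow>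
      complex_of_real (exp (- (norm u)\<^sup>2 / 2))"
    proof (rule noise.martingale_clt_char)
      show "(\<lambda>\<omega>. u \<bullet> w n t \<omega>) \<in> borel_measurable (F (t - 1))" if "1 \<le> t" "t \<le> n" for n t
        using w_F[OF that] by measurable
      show "AE \<omega> in M. (SUP t\<in>{1..}. noise.cond_moment t \<omega>) < \<infinity>"
        using moment unfolding noise.cond_moment_def .
    next
      fix c :: real assume c: "0 < c"
      show "(\<lambda>n. prob {\<omega> \<in> space M. \<exists>t\<in>{1..n}. \<bar>u \<bullet> w n t \<omega>\<bar> > c}) \<longlonglongrightarrow> 0"
      proof (rule prob_tendsto_zero_mono_AE[OF _ _ m_lim[of "c / q"]], rule always_eventually, intro allI AE_I2 impI)
        fix n \<omega> assume "\<omega> \<in> {\<omega> \<in> space M. \<exists>t\<in>{1..n}. \<bar>u \<bullet> w n t \<omega>\<bar> > c}"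
        then obtain t where \<omega>: "\<omega> \<in> space M" and t: "t \<in> {1..n}" "c < \<bar>u \<bullet> w n t \<omega>\<bar>" by auto
        note t(2)
        also have "\<bar>u \<bullet> w n t \<omega>\<bar> \<le> norm u * norm (w n t \<omega>)" by (rule Cauchy_Schwarz_ineq2)
        also have "\<dots> \<le> q * m n \<omega>"
          using q t(1) by (intro mult_mono) (auto simp: m_def)
        finally have "c / q < m n \<omega>" using q by (simp add: field_simps)
        then show "\<omega> \<in> {\<omega> \<in> space M. \<bar>m n \<omega>\<bar> > c / q}" using \<omega> by auto
      qed (use c q in auto)
      show "(\<lambda>n. prob {\<omega> \<in> space M. \<bar>(\<Sum>t=1..n. (u \<bullet> w n t \<omega>)\<^sup>2) - (norm u)\<^sup>2\<bar> > c}) \<longlonglongrightarrow> 0"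
      proof (rule prob_tendsto_zero_mono_AE[OF _ _ r_lim[of "c / q\<^sup>2"]], rule always_eventually, intro allI AE_I2 impI)
        fix n \<omega> assume "\<omega> \<in> {\<omega> \<in> space M. \<bar>(\<Sum>t=1..n. (u \<bullet> w n t \<omega>)\<^sup>2) - (norm u)\<^sup>2\<bar> > c}"
        then have \<omega>: "\<omega> \<in> space M" and gt: "c < \<bar>(\<Sum>t=1..n. (u \<bullet> w n t \<omega>)\<^sup>2) - (norm u)\<^sup>2\<bar>" by auto
        let ?T = "transpose_mult n (\<lambda>t. w n t \<omega>) (\<lambda>t. w n t \<omega>)"
        have "(\<Sum>t=1..n. (u \<bullet> w n t \<omega>)\<^sup>2) = u \<bullet> (?T *v u)"
          by (simp add: transpose_mult_vector inner_sum_right power2_eq_square inner_commute)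
        \<comment> \<open>The variance error is a quadratic form in \<open>mat 1 - ?T\<close>, so
          the operator norm controls it for each fixed \<open>u\<close>.\<close>
        then have "(\<Sum>t=1..n. (u \<bullet> w n t \<omega>)\<^sup>2) - (norm u)\<^sup>2 = - (u \<bullet> ((mat 1 - ?T) *v u))"
          by (simp add: matrix_vector_mult_diff_rdistrib inner_diff_right power2_norm_eq_inner)
        then have "\<bar>(\<Sum>t=1..n. (u \<bullet> w n t \<omega>)\<^sup>2) - (norm u)\<^sup>2\<bar> \<le> norm u * norm ((mat 1 - ?T) *v u)"
          using Cauchy_Schwarz_ineq2[of u "(mat 1 - ?T) *v u"] by simp
        also have "\<dots> \<le> norm u * (r n \<omega> * norm u)"
          unfolding r_def by (intro mult_left_mono onorm[OF matrix_vector_mul_bounded_linear]) auto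
        also have "\<dots> \<le> q * (r n \<omega> * q)" using q r_nonneg by (intro mult_mono) auto
        finally have "c < r n \<omega> * q\<^sup>2" using gt by (simp add: power2_eq_square mult_ac)
        then show "\<omega> \<in> {\<omega> \<in> space M. r n \<omega> > c / q\<^sup>2}" using \<omega> q by (simp add: field_simps)
      qed (use c q in auto)
    qed simp
    also have "(\<lambda>n. CLINT \<omega>|M. iexp (\<Sum>t=1..n. (u \<bullet> w n t \<omega>) * (\<epsilon> t \<omega> / \<sigma>))) =
        (\<lambda>n. CLINT \<omega>|M. iexp (u \<bullet> (S n \<omega> /\<^sub>R \<sigma>)))"
    proof -
      have "(\<Sum>t=1..n. (u \<bullet> w n t \<omega>) * (\<epsilon> t \<omega> / \<sigma>)) = u \<bullet> (S n \<omega> /\<^sub>R \<sigma>)" for n \<omega>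
        by (simp add: S_def inner_sum_right sum_distrib_left divide_inverse mult_ac)
      then show ?thesis by (simp only:)
    qed
    finally show ?thesis by (simp only: char_std_gaussian)
  qed
  have "tendsto_in_distribution M (\<lambda>n \<omega>. Z n \<omega> /\<^sub>R \<sigma>_hat n \<omega>) std_gaussian"
  proof (rule tendsto_in_distribution_relative_perturbation[OF _ _ prob_space_std_gaussian sets_std_gaussian char])
    fix e :: real assume e: "0 < e"
    \<comment> \<open>The two values match the side condition and the factor 6 of
      \<open>studentization_perturbation\<close>.\<close>
    define c where "c = min (1 / 2) (e / 6)"
    have c: "0 < c" "c \<le> 1 / 2" "6 * c \<le> e" using e by (auto simp: c_def)
    define B where "B n = {\<omega> \<in> space M. r n \<omega> > c} \<union> {\<omega> \<in> space M. \<bar>\<sigma>_hat n \<omega> - \<sigma>\<bar> > c * \<sigma>}" for n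
    have [measurable]: "B n \<in> sets M" for n unfolding B_def by measurable
    have B_lim: "(\<lambda>n. prob (B n)) \<longlonglongrightarrow> 0"
    proof (rule tendsto_sandwich[OF _ _ tendsto_const])
      show "\<forall>\<^sub>F n in sequentially. prob (B n) \<le>
          prob {\<omega> \<in> space M. r n \<omega> > c} + prob {\<omega> \<in> space M. \<bar>\<sigma>_hat n \<omega> - \<sigma>\<bar> > c * \<sigma>}"
        unfolding B_def by (intro always_eventually allI measure_Un_le) measurable
      show "(\<lambda>n. prob {\<omega> \<in> space M. r n \<omega> > c} + prob {\<omega> \<in> space M. \<bar>\<sigma>_hat n \<omega> - \<sigma>\<bar> > c * \<sigma>}) \<longlonglongrightarrow> 0"
        using tendsto_add[OF r_lim[OF c(1)] \<sigma>_lim[of "c * \<sigma>"]] c \<sigma> by simp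
    qed simp
    show "(\<lambda>n. prob {\<omega> \<in> space M. norm (Z n \<omega> /\<^sub>R \<sigma>_hat n \<omega> - S n \<omega> /\<^sub>R \<sigma>) > e * norm (S n \<omega> /\<^sub>R \<sigma>)}) \<longlonglongrightarrow> 0"
    proof (rule prob_tendsto_zero_mono_AE[OF _ _ B_lim])
      show "\<forall>\<^sub>F n in sequentially. AE \<omega> in M.
        \<omega> \<in> {\<omega> \<in> space M. norm (Z n \<omega> /\<^sub>R \<sigma>_hat n \<omega> - S n \<omega> /\<^sub>R \<sigma>) > e * norm (S n \<omega> /\<^sub>R \<sigma>)} \<longrightarrow> \<omega> \<in> B n"
        using eventually_ge_at_top[of "CARD('d)"]
      proof eventually_elim
        case (elim n)
        from svd[OF elim] est[OF elim] AE_space show ?case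
        proof eventually_elim
          case (elim \<omega>)
          have "norm (Z n \<omega> /\<^sub>R \<sigma>_hat n \<omega> - S n \<omega> /\<^sub>R \<sigma>) \<le> e * norm (S n \<omega> /\<^sub>R \<sigma>)" if "\<omega> \<notin> B n"
          proof -
            \<comment> \<open>The model equation turns the residuals at the estimator into noise
              minus the effect of the estimation error
              \<open>\<theta>_alee n \<omega> - \<theta>\<close>.\<close>
            have "(\<Sum>t=1..n. (\<epsilon> t \<omega> - x t \<omega> \<bullet> (\<theta>_alee n \<omega> - \<theta>)) *\<^sub>R w n t \<omega>) =
                (\<Sum>t=1..n. (y t \<omega> - x t \<omega> \<bullet> \<theta>_alee n \<omega>) *\<^sub>R w n t \<omega>)"
              using elim y_eq by (intro sum.cong refl) (simp add: inner_diff_right)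
            then have "norm (Z n \<omega> - S n \<omega>) \<le> r n \<omega> * norm (Z n \<omega>)"
              unfolding Z_def S_def r_def
              by (intro thin_svd_estimating_equation[OF elim(1)]) (use elim in simp)
            then have "norm (Z n \<omega> /\<^sub>R \<sigma>_hat n \<omega> - S n \<omega> /\<^sub>R \<sigma>) \<le> 6 * c * norm (S n \<omega> /\<^sub>R \<sigma>)"
              using that elim c \<sigma> by (intro studentization_perturbation[of _ _ "r n \<omega>"]) (auto simp: B_def)
            also have "\<dots> \<le> e * norm (S n \<omega> /\<^sub>R \<sigma>)" using c by (intro mult_right_mono) auto
            finally show ?thesis .
          qed
          then show ?case by (metis (no_types, lifting) mem_Collect_eq not_less)
        qed
      qed
    qed simp
  qed simp_all
  then show ?thesis unfolding Z_def .
qed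

end
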